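(* Consider the Stackelberg game, the assumptions (A1), (A2), (A3)(1a), and the two-loop algorithm described in the context. Suppose (A1), (A2) and (A3)(1a) hold. Set $\eta_t=\bar\eta\,(t+1)^{-1/2}d^{-1}$ and $\delta_t=\bar\delta\,(t+1)^{-1/4}d^{-1/2}$, where $\bar\eta,\bar\delta>0$ and $\bar\eta\le d/(2\tilde\ell)$. Additionally, set $K\ge T^{1/(2\lambda)}d^{2/\lambda}$. Then the iterates of the algorithm satisfy $$\min_{t\in[T]}\mathbb{E}\big[\|\nabla\tilde f(x_t)\|^2\big]\le\tilde O\left(\frac{d}{\sqrt T}\right).$$
   Context: **Game.** Let $X=\mathbb{R}^d$, let $Y\subset\mathbb{R}^{d'}$ be convex and compact, and let $f:X\times Y\to\mathbb{R}$ and $G:X\times Y\to\mathbb{R}^{d'}$ be twice continuously differentiable. For $x\in X$ let $S(x)=\{y\in Y:\langle y'-y,G(x,y)\rangle\ge 0\ \forall y'\in Y\}$ be the solution set of the variational inequality. The Stackelberg game is $\min_{x\in X,y\in Y}f(x,y)$ subject to $y\in S(x)$. Under the singleton assumption below, $S(x)$ is identified with its unique element, and the hyper-objective is $\tilde f(x)=f(x,S(x))$, so the problem is $\min_{x\in X}\tilde f(x)$. A function $h$ is $L$-Lipschitz if $\|h(x)-h(x')\|\le L\|x-x'\|$ for all $x,x'$, and $\ell$-smooth if $\|\nabla h(x)-\nabla h(x')\|\le\ell\|x-x'\|$ for all $x,x'$. **(A1)** (1) For every $y\in Y$, $f(\cdot,y)$ is $L_x$-Lipschitz; for every $x\in X$,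 $f(x,\cdot)$ is $L_y$-Lipschitz and $\ell_y$-smooth. (2) For every $x\in X$, $S(x)$ is a singleton, and $x\mapsto S(x)$ is $L_S$-Lipschitz. (3) $\tilde f$ is twice continuously differentiable, $\tilde L$-Lipschitz and $\tilde\ell$-smooth. **Follower updates.** For $x\in X$ and an initialization $y^{(0)}\in Y$, followers iterate $y^{(k+1)}(x)=H_k(y^{(k)}(x);x)$, $k=0,\dots,K-1$, where $H_k$ is the given update map of an iterative solver and $K$ is a positive integer. **(A2)** There is $C>0$ such that for any $x,\hat x\in X$, the follower updates started from the same initialization satisfy $\|y^{(K)}(x)-y^{(K)}(\hat x)\|\le C\|x-\hat x\|$. **(A3)(1a)** There are positive scalars $\lambda,C$ such that for every $x\in X$ and every initial point $y^{(0)}\in Y$ (and every number $K$ of steps), $\|y^{(K)}(x)-S(x)\|^2\le CK^{-\lambda}\|y^{(0)}-S(x)\|^2$. **Algorithm.** Input: horizon $T$, $K$, initial $x_0\in X$, $y_0^{(0)},\tilde y_0^{(0)}\in Y$, step sizes $(\eta_t)$, perturbation radii $(\delta_t)$. For $t=0,1,\dots,T-1$: sample $v_t$ uniformly (independently of the past) from the unit sphere $\{z\in\mathbb{R}^d:\|z\|_2=1\}$; set $\hat x_t=x_t+\delta_tv_t$; for $k=0,\dots,K-1$ set $\tilde y_t^{(k+1)}=H_k(\tilde y_t^{(k)};x_t)$ and $y_t^{(k+1)}=H_k(y_t^{(k)};\hat x_t)$; set $x_{t+1}=x_t-\eta_t\frac{d}{\delta_t}\big(f(\hat x_t,y_t^{(K)})-f(x_t,\tilde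 y_t^{(K)})\big)v_t$; set $y_{t+1}^{(0)}=\tilde y_{t+1}^{(0)}=\tilde y_t^{(K)}$. **Notation.** $[T]=\{0,1,\dots,T\}$. $\tilde O(\cdot)$ hides factors logarithmic in $T$ and constants not depending on $T$, $d$, $K$.
   Formalization: The hyper-objective is additionally assumed bounded below, with its initial gap a hidden constant (a linear hyper-objective otherwise refutes the claim), and the update maps H_k are assumed Borel measurable so that the expectations are defined. *)

theory Defs
  imports "HOL-Probability.Probability"
begin

section \<open>Euclidean spaces of variable dimension\<close>

text \<open>
  The constant hidden in the rate must not depend on the dimension \<open>d\<close> of the leader's space, so
  \<open>d\<close> has to be quantified after that constant and cannot be a type.  We therefore take the inner
  product space \<open>rvec\<close> of all finitely supported real sequences, and let \<open>Rn d\<close> be its subspace of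
  sequences vanishing from index \<open>d\<close> on, which is a copy of Euclidean \<open>d\<close>-space.
\<close>

typedef rvec = "{c :: nat \<Rightarrow> real. finite {i. c i \<noteq> 0}}"
  morphisms coord Abs_rvec
  by (rule exI [of _ "\<lambda>_. 0"]) simp

setup_lifting type_definition_rvec

lemma rvec_eqI: "(\<And>i. coord x i = coord y i) \<Longrightarrow> x = y"
  by (simp add: coord_inject [symmetric] fun_eq_iff)

lemma finite_support [simp]: "finite {i. coord x i \<noteq> 0}"
  using coord [of x] by simp

instantiation rvec :: real_vector
begin

lift_definition zero_rvec :: rvec is "\<lambda>_. 0"
  by simp

lift_definition plus_rvec :: "rvec \<Rightarrow> rvec \<Rightarrow> rvec" is "\<lambda>x y i. x i + y i"
proof -
  fix x y :: "nat \<Rightarrow> real"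
  assume "finite {i. x i \<noteq> 0}" "finite {i. y i \<noteq> 0}"
  then show "finite {i. x i + y i \<noteq> 0}"
    by (rule finite_subset [OF _ finite_UnI, rotated]) auto
qed

lift_definition uminus_rvec :: "rvec \<Rightarrow> rvec" is "\<lambda>x i. - x i"
  by simp

lift_definition minus_rvec :: "rvec \<Rightarrow> rvec \<Rightarrow> rvec" is "\<lambda>x y i. x i - y i"
proof -
  fix x y :: "nat \<Rightarrow> real"
  assume "finite {i. x i \<noteq> 0}" "finite {i. y i \<noteq> 0}"
  then show "finite {i. x i - y i \<noteq> 0}"
    by (rule finite_subset [OF _ finite_UnI, rotated]) auto
qed

lift_definition scaleR_rvec :: "real \<Rightarrow> rvec \<Rightarrow> rvec" is "\<lambda>r x i. r * x i"
  by (rule rev_finite_subset) auto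

instance
  by standard (transfer; simp add: fun_eq_iff algebra_simps)+

end

lemma coord_simps [simp]:
  "coord 0 i = 0"
  "coord (x + y) i = coord x i + coord y i"
  "coord (- x) i = - coord x i"
  "coord (x - y) i = coord x i - coord y i"
  "coord (r *\<^sub>R x) i = r * coord x i"
  by (transfer; simp)+

instantiation rvec :: real_inner
begin

definition inner_rvec :: "rvec \<Rightarrow> rvec \<Rightarrow> real" where
  "inner_rvec x y = (\<Sum>i | coord x i \<noteq> 0. coord x i * coord y i)"

definition norm_rvec :: "rvec \<Rightarrow> real" where
  "norm_rvec x = sqrt (inner x x)"

definition dist_rvec :: "rvec \<Rightarrow> rvec \<Rightarrow> real" where
  "dist_rvec x y = norm (x - y)"

definition sgn_rvec :: "rvec \<Rightarrow> rvec" where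
  "sgn_rvec x = x /\<^sub>R norm x"

definition uniformity_rvec :: "(rvec \<times> rvec) filter" where
  "uniformity_rvec = (INF e\<in>{0<..}. principal {(x, y). dist x y < e})"

definition open_rvec :: "rvec set \<Rightarrow> bool" where
  "open_rvec U \<longleftrightarrow> (\<forall>x\<in>U. \<forall>\<^sub>F (x', y) in uniformity. x' = x \<longrightarrow> y \<in> U)"

lemma inner_rvec_on:
  assumes "finite A" "{i. coord x i \<noteq> 0} \<subseteq> A"
  shows "inner x y = (\<Sum>i\<in>A. coord x i * coord y i)"
  unfolding inner_rvec_def using assms by (intro sum.mono_neutral_left) auto

instance
proof
  fix x y z :: rvec and r :: real
  let ?A = "{i. coord x i \<noteq> 0} \<union> {i. coord y i \<noteq> 0} \<union> {i. coord z i \<noteq> 0}"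
  have A: "finite ?A" by simp
  show "inner x y = inner y x"
    by (subst (1 2) inner_rvec_on [OF A]) (auto simp: mult.commute)
  show "inner (x + y) z = inner x z + inner y z"
    by (subst (1 2 3) inner_rvec_on [OF A]) (auto simp: algebra_simps sum.distrib)
  show "inner (r *\<^sub>R x) y = r * inner x y"
    by (subst (1 2) inner_rvec_on [OF A]) (auto simp: algebra_simps sum_distrib_left)
  show "0 \<le> inner x x"
    unfolding inner_rvec_def by (intro sum_nonneg) simp
  show "inner x x = 0 \<longleftrightarrow> x = 0"
  proof
    assume "inner x x = 0"
    then have "\<forall>i\<in>{i. coord x i \<noteq> 0}. coord x i * coord x i = 0"
      unfolding inner_rvec_def by (subst (asm) sum_nonneg_eq_0_iff) auto
    then show "x = 0" by (intro rvec_eqI) auto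
  qed (simp add: inner_rvec_def)
qed (simp_all add: norm_rvec_def dist_rvec_def sgn_rvec_def uniformity_rvec_def open_rvec_def)

end

definition Rn :: "nat \<Rightarrow> rvec set" where
  "Rn d = {x. \<forall>i\<ge>d. coord x i = 0}"

lift_definition rvec_of :: "nat \<Rightarrow> (nat \<Rightarrow> real) \<Rightarrow> rvec" is "\<lambda>d c i. if i < d then c i else 0"
  by (rule finite_subset [of _ "{..<_}"]) auto

lemma subspace_Rn: "subspace (Rn d)"
  by (auto simp: subspace_def Rn_def)

lemma Rn_eq_range: "Rn d = range (rvec_of d)"
proof -
  have "x \<in> range (rvec_of d)" if "x \<in> Rn d" for x
    using that by (intro range_eqI [of _ _ "coord x"] rvec_eqI) (auto simp: Rn_def rvec_of.rep_eq)
  then show ?thesis by (auto simp: Rn_def rvec_of.rep_eq)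
qed

lemma inner_Rn: "x \<in> Rn d \<Longrightarrow> x \<bullet> y = (\<Sum>i<d. coord x i * coord y i)"
  by (rule inner_rvec_on) (auto simp: Rn_def not_le [symmetric])

lemma norm_rvec_of: "norm (rvec_of d c) = sqrt (\<Sum>i<d. (c i)\<^sup>2)"
proof -
  have "rvec_of d c \<in> Rn d" by (simp add: Rn_eq_range)
  then show ?thesis
    by (simp add: norm_eq_sqrt_inner inner_Rn rvec_of.rep_eq power2_eq_square)
qed

instance rvec :: second_countable_topology
proof
  define D where "D = range (\<lambda>q :: rat list. rvec_of (length q) (\<lambda>i. of_rat (q ! i)))"
  have D: "countable D" unfolding D_def by simp
  have dense: "\<exists>y\<in>D. dist x y < e" if "e > 0" for x :: rvec and e :: real
  proof -
    have "finite {i. coord x i \<noteq> 0}" by simp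
    then obtain d where d: "\<forall>i\<in>{i. coord x i \<noteq> 0}. i < d"
      unfolding finite_nat_set_iff_bounded by blast
    define r where "r = e / (real d + 1)"
    have r: "r > 0" using that by (simp add: r_def)
    have "\<exists>q. \<bar>coord x i - of_rat q\<bar> < r" for i
    proof -
      obtain q where "coord x i - r < of_rat q" "of_rat q < coord x i + r"
        using of_rat_dense [of "coord x i - r" "coord x i + r"] r by auto
      then have "\<bar>coord x i - of_rat q\<bar> < r" by linarith
      then show ?thesis ..
    qed
    then obtain q where q: "\<And>i. \<bar>coord x i - of_rat (q i)\<bar> < r" by metis
    let ?l = "map q [0..<d]"
    have "rvec_of (length ?l) (\<lambda>i. of_rat (?l ! i)) = rvec_of d (\<lambda>i. of_rat (q i))"
      by (rule rvec_eqI) (simp add: rvec_of.rep_eq)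
    then have mem: "rvec_of d (\<lambda>i. of_rat (q i)) \<in> D"
      unfolding D_def by (intro range_eqI [of _ _ ?l]) simp
    have "dist x (rvec_of d (\<lambda>i. of_rat (q i)))
        = norm (rvec_of d (\<lambda>i. coord x i - of_rat (q i)))"
      unfolding dist_norm using d
      by (intro arg_cong [of _ _ norm] rvec_eqI) (auto simp: rvec_of.rep_eq)
    also have "\<dots> \<le> (\<Sum>i<d. \<bar>coord x i - of_rat (q i)\<bar>)"
      using L2_set_le_sum_abs [of "\<lambda>i. coord x i - of_rat (q i)" "{..<d}"]
      by (simp add: norm_rvec_of L2_set_def)
    also have "\<dots> \<le> (\<Sum>i<d. r)"
      by (intro sum_mono less_imp_le q)
    also have "\<dots> < e"
      using that by (simp add: r_def field_simps)
    finally show ?thesis using mem by blast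
  qed
  define B where "B = (\<lambda>(y, r). ball y (of_rat r)) ` (D \<times> (UNIV :: rat set))"
  have "countable B" using D unfolding B_def by auto
  moreover have "topological_basis B"
  proof (rule topological_basisI)
    fix U :: "rvec set" and x assume "open U" "x \<in> U"
    then obtain e where e: "e > 0" "ball x e \<subseteq> U" by (auto simp: open_contains_ball)
    obtain q :: rat where q: "0 < (of_rat q :: real)" "of_rat q < e / 2"
      using of_rat_dense [of 0 "e / 2"] e by auto
    obtain y where y: "y \<in> D" "dist x y < of_rat q" using dense q by blast
    have "ball y (of_rat q) \<subseteq> U"
    proof
      fix z assume "z \<in> ball y (of_rat q)"
      then have "dist x z < e"
        using dist_triangle [of x z y] y q by simp
      then show "z \<in> U" using e by auto
    qed
    then show "\<exists>B'\<in>B. x \<in> B' \<and> B' \<subseteq> U"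
      using y unfolding B_def by (intro bexI [of _ "ball y (of_rat q)"]) (auto simp: dist_commute)
  qed (auto simp: B_def)
  ultimately show "\<exists>B :: rvec set set. countable B \<and> open = generate_topology B"
    using topological_basis_imp_subbasis by blast
qed

lemma measurable_rvec_of [measurable]: "rvec_of d \<in> Pi\<^sub>M {..<d} (\<lambda>_. lborel) \<rightarrow>\<^sub>M borel"
proof -
  have eq: "rvec_of d c = (\<Sum>i<d. c i *\<^sub>R rvec_of d (\<lambda>j. if j = i then 1 else 0))" for c
  proof (rule rvec_eqI)
    have "coord (\<Sum>i\<in>A. g i) k = (\<Sum>i\<in>A. coord (g i) k)" if "finite A" for g and A :: "nat set" and k
      using that by induction auto
    then show "coord (rvec_of d c) k
        = coord (\<Sum>i<d. c i *\<^sub>R rvec_of d (\<lambda>j. if j = i then 1 else 0)) k" for k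
      by (simp add: rvec_of.rep_eq if_distrib [of "(*) _"] cong: if_cong)
  qed
  have "(\<lambda>c. \<Sum>i<d. c i *\<^sub>R rvec_of d (\<lambda>j. if j = i then 1 else 0))
      \<in> Pi\<^sub>M {..<d} (\<lambda>_. lborel) \<rightarrow>\<^sub>M borel"
    by measurable
  then show ?thesis by (rule measurable_cong [THEN iffD2, OF eq])
qed

section \<open>Differentiability and smoothness\<close>

definition C2_on :: "'a::real_normed_vector set \<Rightarrow> ('a \<Rightarrow> 'b::real_normed_vector) \<Rightarrow> bool" where
  "C2_on S h \<longleftrightarrow> (\<exists>(h' :: 'a \<Rightarrow> 'a \<Rightarrow>\<^sub>L 'b) (h'' :: 'a \<Rightarrow> 'a \<Rightarrow>\<^sub>L 'a \<Rightarrow>\<^sub>L 'b).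
     (\<forall>z\<in>S. (h has_derivative blinfun_apply (h' z)) (at z within S)) \<and>
     (\<forall>z\<in>S. (h' has_derivative blinfun_apply (h'' z)) (at z within S)) \<and>
     continuous_on S h'')"

text \<open>
  The gradient relative to a convex set \<open>S\<close>, normalised to lie in the linear space parallel to the
  affine hull of \<open>S\<close>, which makes it unique.  On \<open>Rn d\<close>, and on a convex set with nonempty
  interior, this is the usual gradient.
\<close>

definition grad :: "'a::real_inner set \<Rightarrow> ('a \<Rightarrow> real) \<Rightarrow> 'a \<Rightarrow> 'a" where
  "grad S h x = (THE g. g \<in> span {b - a | a b. a \<in> S \<and> b \<in> S} \<and>
                        (h has_derivative (\<lambda>u. g \<bullet> u)) (at x within S))"

definition smooth_on :: "real \<Rightarrow> 'a::real_inner set \<Rightarrow> ('a \<Rightarrow> real) \<Rightarrow> bool" where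
  "smooth_on l S h \<longleftrightarrow> h differentiable_on S \<and> l-lipschitz_on S (grad S h)"

section \<open>The Stackelberg game\<close>

definition VI_solutions ::
  "(real ^ 'm) set \<Rightarrow> (rvec \<Rightarrow> real ^ 'm \<Rightarrow> real ^ 'm) \<Rightarrow> rvec \<Rightarrow> (real ^ 'm) set" where
  "VI_solutions Y G x = {y \<in> Y. \<forall>y'\<in>Y. (y' - y) \<bullet> G x y \<ge> 0}"

abbreviation response ::
  "(real ^ 'm) set \<Rightarrow> (rvec \<Rightarrow> real ^ 'm \<Rightarrow> real ^ 'm) \<Rightarrow> rvec \<Rightarrow> real ^ 'm" where
  "response Y G x \<equiv> the_elem (VI_solutions Y G x)"

definition hyper_objective ::
  "(real ^ 'm) set \<Rightarrow> (rvec \<Rightarrow> real ^ 'm \<Rightarrow> real) \<Rightarrow> (rvec \<Rightarrow> real ^ 'm \<Rightarrow> real ^ 'm) \<Rightarrow> rvec \<Rightarrow> real"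
  where "hyper_objective Y f G x = f x (response Y G x)"

definition assumption_A1 ::
  "nat \<Rightarrow> (real ^ 'm) set \<Rightarrow> (rvec \<Rightarrow> real ^ 'm \<Rightarrow> real) \<Rightarrow> (rvec \<Rightarrow> real ^ 'm \<Rightarrow> real ^ 'm) \<Rightarrow>
   real \<Rightarrow> real \<Rightarrow> real \<Rightarrow> real \<Rightarrow> real \<Rightarrow> real \<Rightarrow> bool" where
  "assumption_A1 d Y f G Lx Ly ly LS Lt lt \<longleftrightarrow>
     (\<forall>y\<in>Y. Lx-lipschitz_on (Rn d) (\<lambda>x. f x y)) \<and>
     (\<forall>x\<in>Rn d. Ly-lipschitz_on Y (f x) \<and> smooth_on ly Y (f x)) \<and>
     (\<forall>x\<in>Rn d. is_singleton (VI_solutions Y G x)) \<and>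
     LS-lipschitz_on (Rn d) (response Y G) \<and>
     C2_on (Rn d) (hyper_objective Y f G) \<and>
     Lt-lipschitz_on (Rn d) (hyper_objective Y f G) \<and>
     smooth_on lt (Rn d) (hyper_objective Y f G)"

section \<open>Follower updates\<close>

primrec follower ::
  "(nat \<Rightarrow> real ^ 'm \<Rightarrow> rvec \<Rightarrow> real ^ 'm) \<Rightarrow> rvec \<Rightarrow> real ^ 'm \<Rightarrow> nat \<Rightarrow> real ^ 'm" where
  "follower H x y 0 = y"
| "follower H x y (Suc k) = H k (follower H x y k) x"

text \<open>
  Borel measurability of the update maps is what makes the iterates of the algorithm random
  variables.
\<close>

definition update_maps ::
  "nat \<Rightarrow> (real ^ 'm) set \<Rightarrow> (nat \<Rightarrow> real ^ 'm \<Rightarrow> rvec \<Rightarrow> real ^ 'm) \<Rightarrow> bool" where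
  "update_maps d Y H \<longleftrightarrow>
     (\<forall>k. \<forall>x\<in>Rn d. \<forall>y\<in>Y. H k y x \<in> Y) \<and>
     (\<forall>k. (\<lambda>(y, x). H k y x) \<in> borel_measurable (restrict_space borel (Y \<times> Rn d)))"

definition assumption_A2 ::
  "nat \<Rightarrow> (real ^ 'm) set \<Rightarrow> (nat \<Rightarrow> real ^ 'm \<Rightarrow> rvec \<Rightarrow> real ^ 'm) \<Rightarrow> nat \<Rightarrow> real \<Rightarrow> bool" where
  "assumption_A2 d Y H K C \<longleftrightarrow>
     (\<forall>y\<in>Y. \<forall>x\<in>Rn d. \<forall>x'\<in>Rn d. norm (follower H x y K - follower H x' y K) \<le> C * norm (x - x'))"

definition assumption_A3_1a ::
  "nat \<Rightarrow> (real ^ 'm) set \<Rightarrow> (rvec \<Rightarrow> real ^ 'm \<Rightarrow> real ^ 'm) \<Rightarrow>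
   (nat \<Rightarrow> real ^ 'm \<Rightarrow> rvec \<Rightarrow> real ^ 'm) \<Rightarrow> real \<Rightarrow> real \<Rightarrow> bool" where
  "assumption_A3_1a d Y G H C lam \<longleftrightarrow>
     (\<forall>x\<in>Rn d. \<forall>y\<in>Y. \<forall>K\<ge>1.
        (norm (follower H x y K - response Y G x))\<^sup>2
          \<le> C * real K powr (- lam) * (norm (y - response Y G x))\<^sup>2)"

section \<open>The two-loop zeroth-order algorithm\<close>

text \<open>
  The normalised surface measure of the unit sphere of \<open>Rn d\<close>, obtained as the distribution of
  \<open>z / norm z\<close> for \<open>z\<close> uniform in the (punctured) unit ball.
\<close>

definition unif_sphere :: "nat \<Rightarrow> rvec measure" where
  "unif_sphere d =
     distr (uniform_measure (Pi\<^sub>M {..<d} (\<lambda>_. lborel))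
              {c \<in> space (Pi\<^sub>M {..<d} (\<lambda>_. lborel)). 0 < norm (rvec_of d c) \<and> norm (rvec_of d c) \<le> 1})
           borel (\<lambda>c. rvec_of d c /\<^sub>R norm (rvec_of d c))"

lemma prob_space_unif_sphere:
  assumes "d \<ge> 1"
  shows "prob_space (unif_sphere d)"
proof -
  let ?L = "Pi\<^sub>M {..<d} (\<lambda>_. lborel :: real measure)"
  let ?B = "{c \<in> space ?L. 0 < norm (rvec_of d c) \<and> norm (rvec_of d c) \<le> 1}"
  interpret product_sigma_finite "\<lambda>_ :: nat. lborel :: real measure" by standard
  have B: "?B \<in> sets ?L" by measurable
  have "0 < emeasure ?L (Pi\<^sub>E {..<d} (\<lambda>_. {0<..<1 / real d}))"
    using assms by (subst emeasure_PiM) (auto simp: zero_less_iff_neq_zero)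
  also have "\<dots> \<le> emeasure ?L ?B"
  proof (intro emeasure_mono B subsetI)
    fix c assume c: "c \<in> Pi\<^sub>E {..<d} (\<lambda>_. {0<..<1 / real d})"
    then have c': "0 < c i" "c i < 1 / real d" if "i < d" for i using that by (auto simp: PiE_iff)
    have "norm (rvec_of d c) \<le> (\<Sum>i<d. \<bar>c i\<bar>)"
      using L2_set_le_sum_abs [of c "{..<d}"] by (simp add: norm_rvec_of L2_set_def)
    also have "\<dots> \<le> (\<Sum>i<d. 1 / real d)"
      using c' by (intro sum_mono) (auto simp: less_imp_le)
    finally have "norm (rvec_of d c) \<le> 1" using assms by simp
    moreover have "0 < (\<Sum>i<d. (c i)\<^sup>2)"
    proof (rule sum_pos)
      show "0 < (c i)\<^sup>2" if "i \<in> {..<d}" for i using c' [of i] that by simp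
    qed (use assms in \<open>auto simp: lessThan_empty_iff\<close>)
    ultimately show "c \<in> ?B" using c by (auto simp: norm_rvec_of space_PiM PiE_iff)
  qed
  finally have 1: "emeasure ?L ?B \<noteq> 0" by simp
  have "emeasure ?L ?B \<le> emeasure ?L (Pi\<^sub>E {..<d} (\<lambda>_. {-1..1}))"
  proof (intro emeasure_mono subsetI)
    fix c assume c: "c \<in> ?B"
    have "\<bar>c i\<bar> \<le> 1" if "i < d" for i
    proof -
      have "\<bar>c i\<bar> \<le> norm (rvec_of d c)"
        using that member_le_L2_set [of "{..<d}" i "\<lambda>i. \<bar>c i\<bar>"]
        by (simp add: norm_rvec_of L2_set_def)
      then show ?thesis using c by simp
    qed
    then show "c \<in> Pi\<^sub>E {..<d} (\<lambda>_. {-1..1})" using c by (force simp: space_PiM PiE_iff abs_le_iff)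
  qed measurable
  also have "\<dots> < \<infinity>"
    by (subst emeasure_PiM) (auto simp: power_less_top_ennreal)
  finally have 2: "emeasure ?L ?B \<noteq> \<infinity>" by simp
  have "prob_space (uniform_measure ?L ?B)"
    using 1 2 by (rule prob_space_uniform_measure)
  then show ?thesis
    unfolding unif_sphere_def by (rule prob_space.prob_space_distr) measurable
qed

definition iid_unif_sphere :: "'w measure \<Rightarrow> nat \<Rightarrow> nat \<Rightarrow> (nat \<Rightarrow> 'w \<Rightarrow> rvec) \<Rightarrow> bool" where
  "iid_unif_sphere P d T v \<longleftrightarrow>
     prob_space P \<and> prob_space.indep_vars P (\<lambda>_. borel) v {..<T} \<and>
     (\<forall>t<T. distr P borel (v t) = unif_sphere d)"

text \<open>
  The state at time \<open>t\<close> is the triple of \<open>x\<close>, the initialisation of the follower loop at the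
  perturbed point, and that of the loop at \<open>x\<close>.
\<close>

primrec two_loop ::
  "nat \<Rightarrow> nat \<Rightarrow> (rvec \<Rightarrow> real ^ 'm \<Rightarrow> real) \<Rightarrow> (nat \<Rightarrow> real ^ 'm \<Rightarrow> rvec \<Rightarrow> real ^ 'm) \<Rightarrow>
   (nat \<Rightarrow> real) \<Rightarrow> (nat \<Rightarrow> real) \<Rightarrow> (nat \<Rightarrow> rvec) \<Rightarrow> rvec \<times> (real ^ 'm) \<times> (real ^ 'm) \<Rightarrow>
   nat \<Rightarrow> rvec \<times> (real ^ 'm) \<times> (real ^ 'm)" where
  "two_loop d K f H \<eta> \<delta> v init 0 = init"
| "two_loop d K f H \<eta> \<delta> v init (Suc t) =
     (let (x, y, y') = two_loop d K f H \<eta> \<delta> v init t;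
          xh = x + \<delta> t *\<^sub>R v t;
          yK = follower H xh y K;
          yK' = follower H x y' K
      in (x - (\<eta> t * (real d / \<delta> t) * (f xh yK - f x yK')) *\<^sub>R v t, yK', yK'))"

end

theory Submission
  imports Defs
begin

text \<open>
  Each step moves along the random direction \<open>v\<close> by a multiple of a difference quotient of the
  leader's objective at the responses that the followers have reached.  Write \<open>F\<close> for the
  hyper-objective and let all bounds below be up to constants independent of \<open>d\<close>, \<open>T\<close> and \<open>K\<close>.

  The difference quotient, divided by the radius \<open>\<delta>\<close>, equals \<open>\<nabla>F(x) \<bullet> v\<close> up to a deterministic
  error \<open>\<rho>\<close>, so the step is \<open>- \<eta> d (\<nabla>F(x) \<bullet> v + \<rho>) v\<close>.  Expanding \<open>F\<close> to first order along this step
  and absorbing the cross term into the square gives, for every realisation of the directions,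
  \<open>\<eta> d (\<nabla>F(x) \<bullet> v)\<^sup>2 / 2 \<le> F(x\<^sub>t) - F(x\<^sub>t\<^sub>+\<^sub>1) + \<eta> d \<rho>\<^sup>2 / 2 + lt (step length)\<^sup>2\<close> (\<open>descent_step\<close>).
  Step lengths are of order \<open>\<eta> d\<close>, that is \<open>(t + 1)\<^sup>-\<^sup>1\<^sup>/\<^sup>2\<close>, because for \<open>t \<ge> 1\<close> both follower loops start from the same point, so
  that the observed increment is of order \<open>\<delta>\<close> by (A2).  If also \<open>\<rho>\<^sup>2\<close> is of order \<open>(t + 1)\<^sup>-\<^sup>1\<^sup>/\<^sup>2\<close>, then the last
  two terms are of order \<open>1 / (t + 1)\<close> and telescoping leaves \<open>1 + ln T\<close> on the right
  (\<open>sum_directional_derivatives\<close>).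

  The error \<open>\<rho>\<close> consists of the smoothness error, of order \<open>\<delta>\<close>, and of the distance of the followers
  from their equilibria divided by \<open>\<delta>\<close>.  For the latter it does not suffice that one run of \<open>K\<close> updates
  contracts the error by a factor \<open>q\<close> of order \<open>T\<^sup>-\<^sup>1\<^sup>/\<^sup>4 / d\<close>: dividing by \<open>\<delta>\<close> would give order \<open>d\<^sup>-\<^sup>1\<^sup>/\<^sup>2 ((t + 1) / T)\<^sup>1\<^sup>/\<^sup>4\<close>, which does not decay at \<open>t\<close> near \<open>T\<close>.
  But the loop is warm-started, so the error obeys \<open>a\<^sub>t\<^sub>+\<^sub>1 \<le> q a\<^sub>t + LS (step length)\<close> and hence is itself
  of order \<open>(t + 1)\<^sup>-\<^sup>1\<^sup>/\<^sup>2\<close> as soon as \<open>q \<le> 1 / 4\<close> (\<open>tracking_error\<close>, \<open>estimator_bias\<close>).  The condition on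
  \<open>q\<close> fails only for bounded \<open>T\<close>, where the claim follows from the boundedness of the gradient.

  Only the last step is probabilistic.  The uniform distribution on the sphere has covariance
  \<open>I / d\<close> (\<open>integral_coord_mult_unif_sphere\<close>, by symmetry under permutations and sign changes of
  coordinates), and \<open>v\<^sub>t\<close> is independent of \<open>x\<^sub>t\<close>.  Hence the expectation of \<open>(\<nabla>F(x\<^sub>t) \<bullet> v\<^sub>t)\<^sup>2\<close> is that of
  \<open>\<parallel>\<nabla>F(x\<^sub>t)\<parallel>\<^sup>2 / d\<close> (\<open>second_moment_direction\<close>).  As \<open>\<eta> d\<close> is at least of order \<open>T\<^sup>-\<^sup>1\<^sup>/\<^sup>2\<close>, the sum of
  \<open>T - 1\<close> terms bounds the smallest expected squared gradient by a multiple of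
  \<open>d (1 + ln T) / sqrt T\<close>.
\<close>

section \<open>Differential calculus on coordinate subspaces\<close>

definition unit_coord :: "nat \<Rightarrow> rvec" where
  "unit_coord i = rvec_of (Suc i) (\<lambda>j. if j = i then 1 else 0)"

lemma coord_unit_coord: "coord (unit_coord i) j = (if j = i then 1 else 0)"
  by (simp add: unit_coord_def rvec_of.rep_eq)

lemma inner_unit_coord: "x \<bullet> unit_coord i = coord x i"
proof -
  have "unit_coord i \<in> Rn (Suc i)"
    by (simp add: Rn_def coord_unit_coord)
  then show ?thesis
    by (subst inner_commute) (simp add: inner_Rn coord_unit_coord)
qed

lemma unit_coord_in_Rn: "i < d \<Longrightarrow> unit_coord i \<in> Rn d"
  by (simp add: Rn_def coord_unit_coord)

lemma norm_unit_coord: "norm (unit_coord i) = 1"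
  by (simp add: norm_eq_sqrt_inner inner_unit_coord coord_unit_coord)

lemma continuous_on_coord [continuous_intros]:
  "continuous_on S g \<Longrightarrow> continuous_on S (\<lambda>x. coord (g x) i)"
  unfolding inner_unit_coord [symmetric] by (intro continuous_intros)

lemma measurable_coord [measurable]: "(\<lambda>x. coord x i) \<in> borel_measurable borel"
  by (intro borel_measurable_continuous_onI continuous_on_coord continuous_on_id)

lemma abs_coord_le_norm: "\<bar>coord x i\<bar> \<le> norm x"
  using Cauchy_Schwarz_ineq2 [of x "unit_coord i"]
  by (simp add: inner_unit_coord norm_unit_coord)

lemma closed_Rn: "closed (Rn d)"
proof -
  have "Rn d = (\<Inter>i\<in>{d..}. {x. coord x i = 0})"
    by (auto simp: Rn_def)
  also have "closed \<dots>"
    by (intro closed_INT ballI closed_Collect_eq continuous_intros)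
  finally show ?thesis .
qed

lemma Rn_ops:
  "x \<in> Rn d \<Longrightarrow> y \<in> Rn d \<Longrightarrow> x + y \<in> Rn d"
  "x \<in> Rn d \<Longrightarrow> y \<in> Rn d \<Longrightarrow> x - y \<in> Rn d"
  "x \<in> Rn d \<Longrightarrow> r *\<^sub>R x \<in> Rn d"
  by (simp_all add: Rn_def)

lemma span_differences_Rn: "span {b - a | a b. a \<in> Rn d \<and> b \<in> Rn d} = Rn d"
proof -
  have "{b - a | a b. a \<in> Rn d \<and> b \<in> Rn d} = Rn d"
  proof (intro equalityI subsetI)
    fix x assume "x \<in> Rn d"
    moreover have "x = x - 0" "0 \<in> Rn d" by (simp_all add: Rn_def)
    ultimately show "x \<in> {b - a | a b. a \<in> Rn d \<and> b \<in> Rn d}" by blast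
  qed (auto intro: Rn_ops)
  then show ?thesis
    by (simp add: subspace_Rn span_eq_iff)
qed

text \<open>
  A linear functional on the whole space need not be the inner product with a vector; on \<open>Rn d\<close> finitely many basis vectors suffice.
\<close>

lemma linear_eq_inner_on_Rn:
  assumes "linear L" "u \<in> Rn d"
  shows "L u = rvec_of d (\<lambda>i. L (unit_coord i)) \<bullet> u"
proof -
  have sum_coord: "coord (\<Sum>i\<in>A. g i) k = (\<Sum>i\<in>A. coord (g i) k)" if "finite A"
    for g and A :: "nat set" and k
    using that by induction auto
  have "u = (\<Sum>i<d. coord u i *\<^sub>R unit_coord i)"
    using \<open>u \<in> Rn d\<close>
    by (intro rvec_eqI)
       (auto simp: sum_coord coord_unit_coord Rn_def if_distrib [of "(*) _"] not_less cong: if_cong)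
  then have "L u = (\<Sum>i<d. coord u i *\<^sub>R L (unit_coord i))"
    using linear_sum [OF \<open>linear L\<close>, of "\<lambda>i. coord u i *\<^sub>R unit_coord i" "{..<d}"]
      linear_cmul [OF \<open>linear L\<close>] by simp
  also have "\<dots> = rvec_of d (\<lambda>i. L (unit_coord i)) \<bullet> u"
    by (subst inner_Rn [of _ d]) (auto simp: Rn_eq_range rvec_of.rep_eq mult.commute)
  finally show ?thesis .
qed

lemma has_real_derivative_along_line:
  assumes "(h has_derivative (\<lambda>u. g \<bullet> u)) (at (x + s *\<^sub>R u) within Rn d)" "x \<in> Rn d" "u \<in> Rn d"
  shows "((\<lambda>r. h (x + r *\<^sub>R u)) has_real_derivative g \<bullet> u) (at s)"
proof -
  have line: "((\<lambda>r. x + r *\<^sub>R u) has_derivative (\<lambda>r. r *\<^sub>R u)) (at s)"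
    by (auto intro!: derivative_eq_intros)
  have "range (\<lambda>r. x + r *\<^sub>R u) \<subseteq> Rn d"
    using assms by (auto intro: Rn_ops)
  from has_derivative_in_compose [OF line has_derivative_subset [OF assms(1) this]]
  have "((\<lambda>r. h (x + r *\<^sub>R u)) has_derivative (\<lambda>r. g \<bullet> (r *\<^sub>R u))) (at s)" .
  then show ?thesis
    by (simp add: has_field_derivative_def mult_commute_abs)
qed

text \<open>
  The derivative supplied by differentiability may be any linear map off \<open>Rn d\<close>.  Its values on
  the basis vectors give a representing vector, and restricting to lines shows that there is only one,
  so the description defining \<open>grad\<close> denotes it.
\<close>

lemma grad_Rn:
  assumes "h differentiable_on Rn d" "x \<in> Rn d"
  shows "grad (Rn d) h x \<in> Rn d"
    and "(h has_derivative (\<lambda>u. grad (Rn d) h x \<bullet> u)) (at x within Rn d)"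
proof -
  let ?P = "\<lambda>g. g \<in> Rn d \<and> (h has_derivative (\<lambda>u. g \<bullet> u)) (at x within Rn d)"
  obtain L where L: "(h has_derivative L) (at x within Rn d)"
    using assms by (auto simp: differentiable_on_def differentiable_def)
  define g where "g = rvec_of d (\<lambda>i. L (unit_coord i))"
  have "L (y - x) = g \<bullet> (y - x)" if "y \<in> Rn d" for y
    unfolding g_def using assms(2) that has_derivative_linear [OF L]
    by (intro linear_eq_inner_on_Rn Rn_ops)
  then have "(h has_derivative (\<lambda>u. g \<bullet> u)) (at x within Rn d)"
    using L unfolding has_derivative_within
    by (auto intro: bounded_linear_inner_right cong: Lim_cong_within)
  then have g: "?P g"
    by (simp add: g_def Rn_eq_range)
  have unique: "g1 = g2" if "?P g1" "?P g2" for g1 g2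
  proof -
    let ?u = "g1 - g2"
    have u: "?u \<in> Rn d" using that by (auto intro: Rn_ops)
    have "((\<lambda>r. h (x + r *\<^sub>R ?u)) has_real_derivative k \<bullet> ?u) (at 0)" if "?P k" for k
      using that assms(2) u by (intro has_real_derivative_along_line [where d = d]) auto
    then have "g1 \<bullet> ?u = g2 \<bullet> ?u"
      using that DERIV_unique by blast
    then have "?u \<bullet> ?u = 0"
      by (simp add: inner_diff_left)
    then show ?thesis by simp
  qed
  have "?P (THE g. ?P g)"
    by (rule theI [of ?P, OF g]) (use g unique in blast)
  then show "grad (Rn d) h x \<in> Rn d"
    and "(h has_derivative (\<lambda>u. grad (Rn d) h x \<bullet> u)) (at x within Rn d)"
    by (simp_all add: grad_def span_differences_Rn)
qed

text \<open>
  This is the mean value theorem on the segment from \<open>x\<close> to \<open>x + u\<close>.  Integrating the gradient instead would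
  give \<open>l / 2\<close>, but the factor is immaterial for the rate.
\<close>

lemma smooth_on_quadratic_bound:
  assumes "smooth_on l (Rn d) h" "x \<in> Rn d" "u \<in> Rn d"
  shows "\<bar>h (x + u) - h x - grad (Rn d) h x \<bullet> u\<bar> \<le> l * (norm u)\<^sup>2"
proof -
  let ?g = "grad (Rn d) h"
  have diff: "h differentiable_on Rn d" and lip: "l-lipschitz_on (Rn d) ?g"
    using assms by (auto simp: smooth_on_def)
  have mem: "x + s *\<^sub>R u \<in> Rn d" for s
    using assms by (auto intro: Rn_ops)
  have "\<exists>s. 0 < s \<and> s < 1 \<and> h (x + 1 *\<^sub>R u) - h (x + 0 *\<^sub>R u) = (1 - 0) * (?g (x + s *\<^sub>R u) \<bullet> u)"
    using assms(2,3) by (intro MVT2 has_real_derivative_along_line [where d = d] grad_Rn diff mem) auto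
  then obtain s where s: "0 < s" "s < 1" "h (x + u) - h x = ?g (x + s *\<^sub>R u) \<bullet> u"
    by auto
  have "\<bar>h (x + u) - h x - ?g x \<bullet> u\<bar> = \<bar>(?g (x + s *\<^sub>R u) - ?g x) \<bullet> u\<bar>"
    using s by (simp add: inner_diff_left)
  also have "\<dots> \<le> norm (?g (x + s *\<^sub>R u) - ?g x) * norm u"
    by (rule Cauchy_Schwarz_ineq2)
  also have "\<dots> \<le> (l * norm (s *\<^sub>R u)) * norm u"
    using lipschitz_onD [OF lip mem [of s] assms(2)]
    by (intro mult_right_mono) (simp_all add: dist_norm)
  also have "\<dots> \<le> (l * norm u) * norm u"
    using s lipschitz_on_nonneg [OF lip] by (intro mult_right_mono mult_left_mono) (auto intro: mult_left_le_one_le)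
  finally show ?thesis by (simp add: power2_eq_square)
qed

text \<open>
  Along the gradient, over a distance proportional to its length, \<open>h\<close> grows at least by half of what its
  linearisation predicts, while the Lipschitz bound limits that growth.
\<close>

lemma norm_grad_le:
  assumes "smooth_on l (Rn d) h" "L-lipschitz_on (Rn d) h" "l > 0" "x \<in> Rn d"
  shows "norm (grad (Rn d) h x) \<le> 2 * L"
proof (cases "grad (Rn d) h x = 0")
  case True
  then show ?thesis using lipschitz_on_nonneg [OF assms(2)] by simp
next
  case False
  let ?g = "grad (Rn d) h x"
  define u where "u = (1 / (2 * l)) *\<^sub>R ?g"
  have u: "u \<in> Rn d"
    unfolding u_def using assms by (intro Rn_ops grad_Rn) (auto simp: smooth_on_def)
  have "?g \<bullet> u \<le> \<bar>h (x + u) - h x\<bar> + l * (norm u)\<^sup>2"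
    using smooth_on_quadratic_bound [OF assms(1,4) u] by linarith
  also have "\<bar>h (x + u) - h x\<bar> \<le> L * norm u"
    using lipschitz_onD [OF assms(2), of "x + u" x] u assms(4) by (auto simp: dist_norm Rn_ops)
  finally have "?g \<bullet> u \<le> L * norm u + l * (norm u)\<^sup>2" by simp
  moreover have "?g \<bullet> u = (norm ?g)\<^sup>2 / (2 * l)" "norm u = norm ?g / (2 * l)"
    using assms(3) by (simp_all add: u_def power2_norm_eq_inner)
  ultimately have "(norm ?g)\<^sup>2 / (2 * l) \<le> L * (norm ?g / (2 * l)) + l * (norm ?g / (2 * l))\<^sup>2"
    by simp
  then have "norm ?g * norm ?g \<le> (2 * L) * norm ?g"
    using assms(3) by (simp add: field_simps power2_eq_square)
  then show ?thesis using False by simp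
qed

section \<open>Second moments of the uniform distribution on the sphere\<close>

text \<open>
  Lebesgue measure on the line is invariant under reflection and the factors are equal, so the product
  measure of a box does not change when its sides are permuted and reflected; boxes determine the product
  measure.
\<close>

lemma distr_signed_permutation_PiM_lborel:
  fixes I :: "nat set" and s :: "nat \<Rightarrow> real"
  assumes "finite I" "bij_betw \<pi> I I" "\<And>k. s k \<in> {1, -1}"
  shows "distr (Pi\<^sub>M I (\<lambda>_. lborel)) (Pi\<^sub>M I (\<lambda>_. lborel)) (\<lambda>c. \<lambda>k\<in>I. s k * c (\<pi> k))
    = Pi\<^sub>M I (\<lambda>_. lborel)"
proof -
  let ?L = "Pi\<^sub>M I (\<lambda>_. lborel :: real measure)"
  interpret product_sigma_finite "\<lambda>_ :: nat. lborel :: real measure" by standard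
  have \<pi>: "\<pi> k \<in> I" if "k \<in> I" for k
    using that assms(2) by (auto simp: bij_betw_def)
  have "(\<lambda>c. c (\<pi> k)) \<in> ?L \<rightarrow>\<^sub>M borel" if "k \<in> I" for k
    using measurable_component_singleton [of "\<pi> k" I "\<lambda>_. lborel"] \<pi> [OF that] by simp
  then have T: "(\<lambda>c. \<lambda>k\<in>I. s k * c (\<pi> k)) \<in> ?L \<rightarrow>\<^sub>M ?L"
    by (intro measurable_restrict) simp
  have "emeasure (distr ?L ?L (\<lambda>c. \<lambda>k\<in>I. s k * c (\<pi> k))) (Pi\<^sub>E I A) = (\<Prod>k\<in>I. emeasure lborel (A k))"
    if A: "\<And>k. k \<in> I \<Longrightarrow> A k \<in> sets lborel" for A
  proof -
    define \<sigma> where "\<sigma> = inv_into I \<pi>"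
    have \<sigma>: "\<sigma> k \<in> I" "\<pi> (\<sigma> k) = k" if "k \<in> I" for k
      using that assms(2) by (auto simp: \<sigma>_def bij_betw_def f_inv_into_f inv_into_into)
    have \<sigma>\<pi>: "\<sigma> (\<pi> k) = k" if "k \<in> I" for k
      using that assms(2) by (auto simp: \<sigma>_def bij_betw_def)
    let ?B = "\<lambda>k. (\<lambda>r. s (\<sigma> k) * r) -` A (\<sigma> k)"
    have flip: "(\<lambda>r. s k * r) -` A k \<in> sets lborel \<and>
        emeasure lborel ((\<lambda>r. s k * r) -` A k) = emeasure lborel (A k)" if "k \<in> I" for k
    proof -
      have m: "(\<lambda>r :: real. s k * r) \<in> lborel \<rightarrow>\<^sub>M lborel" by simp
      have "distr lborel lborel (\<lambda>r :: real. s k * r) = lborel"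
        using assms(3) [of k] lborel_distr_uminus by (auto simp: distr_id2 cong: distr_cong)
      then show ?thesis
        using emeasure_distr [OF m A [OF that]] measurable_sets [OF m A [OF that]]
        by simp
    qed
    have "(\<lambda>c. \<lambda>k\<in>I. s k * c (\<pi> k)) -` Pi\<^sub>E I A \<inter> space ?L = Pi\<^sub>E I ?B"
      using \<pi> \<sigma> \<sigma>\<pi> by (auto simp: space_PiM PiE_iff) (metis)+
    then have "emeasure (distr ?L ?L (\<lambda>c. \<lambda>k\<in>I. s k * c (\<pi> k))) (Pi\<^sub>E I A) = emeasure ?L (Pi\<^sub>E I ?B)"
      using T A assms(1) by (subst emeasure_distr) (auto intro!: sets_PiM_I_finite)
    also have "\<dots> = (\<Prod>k\<in>I. emeasure lborel (?B k))"
      using flip \<sigma> assms(1) by (intro emeasure_PiM) auto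
    also have "\<dots> = (\<Prod>k\<in>I. emeasure lborel (A (\<sigma> k)))"
      using flip \<sigma> by (intro prod.cong) auto
    also have "\<dots> = (\<Prod>k\<in>I. emeasure lborel (A k))"
      using assms(2) by (intro prod.reindex_bij_betw) (simp add: \<sigma>_def bij_betw_inv_into)
    finally show ?thesis .
  qed
  then show ?thesis
    using assms(1) by (intro PiM_eqI) auto
qed

lemma borel_measurable_rvec_of [measurable (raw)]:
  assumes "\<And>k. k < d \<Longrightarrow> g k \<in> borel_measurable N"
  shows "(\<lambda>x. rvec_of d (\<lambda>k. g k x)) \<in> borel_measurable N"
proof -
  have "(\<lambda>x. rvec_of d (\<lambda>k\<in>{..<d}. g k x)) \<in> borel_measurable N"
    using assms by (intro measurable_compose [OF _ measurable_rvec_of] measurable_restrict) auto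
  moreover have "rvec_of d (\<lambda>k\<in>{..<d}. g k x) = rvec_of d (\<lambda>k. g k x)" for x
    by (rule rvec_eqI) (simp add: rvec_of.rep_eq)
  ultimately show ?thesis by simp
qed

abbreviation punctured_ball :: "nat \<Rightarrow> (nat \<Rightarrow> real) set" where
  "punctured_ball d \<equiv> {c \<in> space (Pi\<^sub>M {..<d} (\<lambda>_. lborel)). 0 < norm (rvec_of d c) \<and> norm (rvec_of d c) \<le> 1}"

definition unit_dirs :: "nat \<Rightarrow> rvec set" where
  "unit_dirs d = {u \<in> Rn d. norm u = 1}"

lemma unit_dirs_borel: "unit_dirs d \<in> sets borel"
proof -
  have "unit_dirs d = Rn d \<inter> (norm -` {1})" by (auto simp: unit_dirs_def)
  moreover have "closed (norm -` {1} :: rvec set)"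
    by (intro closed_vimage) (auto intro: continuous_intros)
  ultimately show ?thesis
    using closed_Rn by (auto intro: borel_closed)
qed

lemma AE_unif_sphere_unit_dirs:
  assumes "d \<ge> 1"
  shows "AE u in unif_sphere d. u \<in> unit_dirs d"
proof -
  have B: "punctured_ball d \<in> sets (Pi\<^sub>M {..<d} (\<lambda>_. lborel))" by measurable
  have "AE c in uniform_measure (Pi\<^sub>M {..<d} (\<lambda>_. lborel)) (punctured_ball d).
      rvec_of d c /\<^sub>R norm (rvec_of d c) \<in> unit_dirs d"
    using B by (intro AE_uniform_measureI AE_I2) (auto simp: unit_dirs_def Rn_eq_range intro!: Rn_ops [unfolded Rn_eq_range])
  then show ?thesis
    unfolding unif_sphere_def using unit_dirs_borel by (subst AE_distr_iff) auto
qed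

text \<open>
  Signed permutations preserve the norm, hence the punctured ball, and they commute with normalisation.
\<close>

lemma distr_signed_permutation_unif_sphere:
  fixes s :: "nat \<Rightarrow> real"
  assumes "bij_betw \<pi> {..<d} {..<d}" "\<And>k. s k \<in> {1, -1}"
  shows "distr (unif_sphere d) borel (\<lambda>u. rvec_of d (\<lambda>k. s k * coord u (\<pi> k))) = unif_sphere d"
proof -
  let ?L = "Pi\<^sub>M {..<d} (\<lambda>_. lborel :: real measure)"
  let ?U = "uniform_measure ?L (punctured_ball d)"
  let ?T = "\<lambda>c. \<lambda>k\<in>{..<d}. s k * c (\<pi> k)"
  let ?Q = "\<lambda>u. rvec_of d (\<lambda>k. s k * coord u (\<pi> k))"
  let ?N = "\<lambda>c. rvec_of d c /\<^sub>R norm (rvec_of d c)"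
  have B: "punctured_ball d \<in> sets ?L" by measurable
  have \<pi>: "\<pi> k < d" if "k < d" for k
    using that assms(1) by (auto simp: bij_betw_def)
  have "(\<lambda>c. c (\<pi> k)) \<in> ?L \<rightarrow>\<^sub>M borel" if "k < d" for k
    using measurable_component_singleton [of "\<pi> k" "{..<d}" "\<lambda>_. lborel"] \<pi> [OF that] by simp
  then have T: "?T \<in> ?L \<rightarrow>\<^sub>M ?L"
    by (intro measurable_restrict) simp
  have N: "?N \<in> ?L \<rightarrow>\<^sub>M borel" by measurable
  have Q: "?Q \<in> borel \<rightarrow>\<^sub>M borel"
    by measurable
  have [simp]: "(s k)\<^sup>2 = 1" for k
    using assms(2) [of k] by auto
  have norm_T: "norm (rvec_of d (?T c)) = norm (rvec_of d c)" for c
    unfolding norm_rvec_of using sum.reindex_bij_betw [OF assms(1), of "\<lambda>k. (c k)\<^sup>2"]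
    by (simp add: power_mult_distrib)
  have QN: "?Q (?N c) = ?N (?T c)" for c
    unfolding norm_T using \<pi> by (intro rvec_eqI) (auto simp: rvec_of.rep_eq)
  have ball_T: "?T -` (punctured_ball d \<inter> A) \<inter> space ?L = punctured_ball d \<inter> (?T -` A \<inter> space ?L)" for A
    using measurable_space [OF T] by (auto simp: norm_T simp del: zero_less_norm_iff)
  have "distr ?U ?L ?T = ?U"
  proof (rule measure_eqI)
    fix A assume "A \<in> sets (distr ?U ?L ?T)"
    then have A: "A \<in> sets ?L" by simp
    have "emeasure (distr ?U ?L ?T) A = emeasure ?U (?T -` A \<inter> space ?L)"
      using A T by (subst emeasure_distr) auto
    also have "\<dots> = emeasure ?L (?T -` (punctured_ball d \<inter> A) \<inter> space ?L) / emeasure ?L (punctured_ball d)"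
      unfolding ball_T using B measurable_sets [OF T A] by (rule emeasure_uniform_measure)
    also have "emeasure ?L (?T -` (punctured_ball d \<inter> A) \<inter> space ?L) = emeasure (distr ?L ?L ?T) (punctured_ball d \<inter> A)"
      using T A B by (subst emeasure_distr) auto
    also have "distr ?L ?L ?T = ?L"
      using assms by (intro distr_signed_permutation_PiM_lborel) auto
    also have "emeasure ?L (punctured_ball d \<inter> A) / emeasure ?L (punctured_ball d) = emeasure ?U A"
      using A B by simp
    finally show "emeasure (distr ?U ?L ?T) A = emeasure ?U A" .
  qed simp
  then have "distr ?U borel ?N = distr (distr ?U ?L ?T) borel ?N"
    by simp
  also have "\<dots> = distr ?U borel (\<lambda>c. ?N (?T c))"
    using T N by (subst distr_distr) (auto simp: comp_def)
  also have "\<dots> = distr (distr ?U borel ?N) borel ?Q"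
    unfolding QN [symmetric] using Q N by (subst distr_distr) (auto simp: comp_def)
  finally show ?thesis
    by (simp add: unif_sphere_def)
qed

text \<open>
  Reflecting one coordinate changes the sign of a mixed moment, which therefore vanishes.  Swapping
  coordinates shows that all pure moments agree, and they add up to the mean of \<open>\<parallel>u\<parallel>\<^sup>2 = 1\<close>.
\<close>

lemma integral_coord_mult_unif_sphere:
  assumes "i < d" "j < d"
  shows "(\<integral>u. coord u i * coord u j \<partial>unif_sphere d) = (if i = j then 1 / real d else 0)"
proof -
  have d: "d \<ge> 1" using assms by simp
  interpret S: prob_space "unif_sphere d"
    using d by (rule prob_space_unif_sphere)
  have sets_S [measurable_cong, simp]: "sets (unif_sphere d) = sets borel"
    by (simp add: unif_sphere_def)
  have invariant: "(\<integral>u. coord u k * coord u l \<partial>unif_sphere d) =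
      (\<integral>u. (s k * coord u (\<pi> k)) * (s l * coord u (\<pi> l)) \<partial>unif_sphere d)"
    if "bij_betw \<pi> {..<d} {..<d}" "\<And>k. s k \<in> {1, -1}" "k < d" "l < d" for s :: "nat \<Rightarrow> real" and \<pi> k l
  proof -
    have Q: "(\<lambda>u. rvec_of d (\<lambda>k. s k * coord u (\<pi> k))) \<in> unif_sphere d \<rightarrow>\<^sub>M borel"
      by measurable
    show ?thesis
      using that Q
      by (subst distr_signed_permutation_unif_sphere [OF that(1,2), symmetric], subst integral_distr)
         (auto simp: rvec_of.rep_eq)
  qed
  show ?thesis
  proof (cases "i = j")
    case False
    have "(\<integral>u. coord u i * coord u j \<partial>unif_sphere d) = - (\<integral>u. coord u i * coord u j \<partial>unif_sphere d)"
      using invariant [of id "\<lambda>k. if k = i then -1 else 1" i j] False assms by (auto simp: bij_betw_id)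
    then show ?thesis using False by simp
  next
    case True
    have "(\<integral>u. coord u k * coord u k \<partial>unif_sphere d) = (\<integral>u. coord u i * coord u i \<partial>unif_sphere d)"
      if "k < d" for k
    proof -
      have "bij_betw (Transposition.transpose i k) {..<d} {..<d}"
        using that assms by (intro bij_betw_byWitness [where f' = "Transposition.transpose i k"])
          (auto simp: Transposition.transpose_def split: if_splits)
      then show ?thesis
        using invariant [of "Transposition.transpose i k" "\<lambda>_. 1" k k] that by simp
    qed
    then have "(\<Sum>k<d. \<integral>u. coord u k * coord u k \<partial>unif_sphere d) =
        real d * (\<integral>u. coord u i * coord u i \<partial>unif_sphere d)"
      by simp
    moreover have "(\<Sum>k<d. \<integral>u. coord u k * coord u k \<partial>unif_sphere d) = 1"
    proof -
      have int: "integrable (unif_sphere d) (\<lambda>u. coord u k * coord u k)" for k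
      proof (rule S.integrable_const_bound [where B = 1])
        have bound: "norm (coord u k * coord u k) \<le> 1" if "u \<in> unit_dirs d" for u
          using that abs_coord_le_norm [of u k]
          by (simp add: unit_dirs_def abs_square_le_1 flip: power2_eq_square)
        show "AE u in unif_sphere d. norm (coord u k * coord u k) \<le> 1"
          using AE_unif_sphere_unit_dirs [OF d] by eventually_elim (rule bound)
      qed measurable
      then have "(\<Sum>k<d. \<integral>u. coord u k * coord u k \<partial>unif_sphere d)
          = (\<integral>u. (\<Sum>k<d. coord u k * coord u k) \<partial>unif_sphere d)"
        by simp
      also have "\<dots> = (\<integral>u. 1 \<partial>unif_sphere d)"
      proof (rule integral_cong_AE)
        show "AE u in unif_sphere d. (\<Sum>k<d. coord u k * coord u k) = 1"
          using AE_unif_sphere_unit_dirs [OF d]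
          by eventually_elim (auto simp: unit_dirs_def inner_Rn [symmetric] dot_square_norm)
      qed measurable
      finally show ?thesis by (simp add: S.prob_space)
    qed
    ultimately show ?thesis using True d by (simp add: field_simps)
  qed
qed

section \<open>Constants, step sizes and the follower loop\<close>

lemma sum_inverse_le_ln: "(\<Sum>t<n. 1 / (real (Suc t) + 1)) \<le> ln (real n + 1)"
proof (induction n)
  case (Suc n)
  have "1 / (real n + 2) \<le> ln (real n + 2) - ln (real n + 1)"
    using ln_diff_le [of "real n + 1" "real n + 2"] by (simp add: field_simps)
  then show ?case using Suc by (simp add: algebra_simps)
qed simp

text \<open>
  The constants of the analysis depend only on the data that are fixed before \<open>d\<close>, \<open>T\<close> and \<open>K\<close>; \<open>D\<close> stands
  for a bound on the diameter of \<open>Y\<close>.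
\<close>

locale rate_constants =
  fixes Lx Ly LS Lt lt C2 C3 etabar deltabar gap D :: real
begin

text \<open>
  If \<open>K\<close> updates reduce the error of the followers at least to a quarter, the following hold, with
  \<open>s = (t + 1)\<^sup>-\<^sup>1\<^sup>/\<^sup>4\<close> for iteration \<open>t\<close>: the first displacement is at most \<open>first_step\<close>, and for
  \<open>t \<ge> 1\<close> the displacement is at most \<open>speed * s\<^sup>2\<close>, the distance between the warm start of the followers and
  their equilibrium at most \<open>lag * s\<^sup>2\<close>, the error of the directional derivative at most \<open>bias * s\<close>, and the
  loss in the descent inequality at most \<open>drift * s ^ 4\<close>.  The sum of all gains is at most
  \<open>budget * (1 + ln T)\<close>.  The second summand of \<open>rate\<close> serves the small horizons \<open>T\<close>.
\<close>

definition "first_step = etabar * (Lt + 2 * Ly * D * sqrt C3 / deltabar)"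
definition "speed = etabar * (Lx + Ly * C2)"
definition "lag = 2 * (D + LS * first_step) + 4 * (LS * speed)"
definition "bias = lt * deltabar + Ly * sqrt C3 * (2 * lag / deltabar + LS)"
definition "drift = etabar * bias\<^sup>2 / 2 + lt * speed\<^sup>2"
definition "budget = Lt * first_step + gap + drift"
definition "rate = 4 * budget / etabar + 4 * Lt\<^sup>2 * (16 * C3 + 2)"

end

locale two_loop_game = rate_constants +
  fixes Y :: "(real ^ 'm) set" and ly lam :: real and d T K :: nat
    and f :: "rvec \<Rightarrow> real ^ 'm \<Rightarrow> real" and G :: "rvec \<Rightarrow> real ^ 'm \<Rightarrow> real ^ 'm"
    and H :: "nat \<Rightarrow> real ^ 'm \<Rightarrow> rvec \<Rightarrow> real ^ 'm"
    and x0 :: rvec and y0 y0' :: "real ^ 'm"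
  assumes pos: "lt > 0" "C2 > 0" "C3 > 0" "lam > 0" "etabar > 0" "deltabar > 0"
    and diam: "\<And>y y'. y \<in> Y \<Longrightarrow> y' \<in> Y \<Longrightarrow> norm (y - y') \<le> D"
    and dTK: "d \<ge> 1" "T \<ge> 1" "K \<ge> 1"
    and C2_f: "C2_on (Rn d \<times> Y) (\<lambda>(x, y). f x y)"
    and updates: "update_maps d Y H"
    and A1: "assumption_A1 d Y f G Lx Ly ly LS Lt lt"
    and A2: "assumption_A2 d Y H K C2"
    and A3: "assumption_A3_1a d Y G H C3 lam"
    and init: "x0 \<in> Rn d" "y0 \<in> Y" "y0' \<in> Y"
    and gap: "\<And>x. x \<in> Rn d \<Longrightarrow> hyper_objective Y f G x0 - hyper_objective Y f G x \<le> gap"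
    and K_ge: "real K \<ge> real T powr (1 / (2 * lam)) * real d powr (2 / lam)"
begin

abbreviation F :: "rvec \<Rightarrow> real" where "F \<equiv> hyper_objective Y f G"
abbreviation S :: "rvec \<Rightarrow> real ^ 'm" where "S \<equiv> response Y G"
abbreviation gradF :: "rvec \<Rightarrow> rvec" where "gradF \<equiv> grad (Rn d) F"

definition eta :: "nat \<Rightarrow> real" where
  "eta t = etabar * (real t + 1) powr (- 1 / 2) * real d powr (- 1)"

definition delta :: "nat \<Rightarrow> real" where
  "delta t = deltabar * (real t + 1) powr (- 1 / 4) * real d powr (- 1 / 2)"

definition decay :: "nat \<Rightarrow> real" where
  "decay t = (real t + 1) powr (- 1 / 4)"

definition contraction :: real where
  "contraction = sqrt (C3 * real K powr (- lam))"

lemma smooth_F: "smooth_on lt (Rn d) F" and lipschitz_F: "Lt-lipschitz_on (Rn d) F"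
  and lipschitz_S: "LS-lipschitz_on (Rn d) S"
  and lipschitz_f1: "y \<in> Y \<Longrightarrow> Lx-lipschitz_on (Rn d) (\<lambda>x. f x y)"
  and lipschitz_f2: "x \<in> Rn d \<Longrightarrow> Ly-lipschitz_on Y (f x)"
  using A1 by (auto simp: assumption_A1_def)

lemma S_in_Y: "x \<in> Rn d \<Longrightarrow> S x \<in> Y"
proof -
  assume "x \<in> Rn d"
  then have "is_singleton (VI_solutions Y G x)"
    using A1 by (auto simp: assumption_A1_def)
  then have "S x \<in> VI_solutions Y G x"
    by (metis is_singleton_the_elem singletonI)
  then show ?thesis by (simp add: VI_solutions_def)
qed

lemma follower_in_Y: "x \<in> Rn d \<Longrightarrow> y \<in> Y \<Longrightarrow> follower H x y k \<in> Y"
  using updates by (induction k) (auto simp: update_maps_def)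

lemma nonneg: "Lx \<ge> 0" "Ly \<ge> 0" "LS \<ge> 0" "Lt \<ge> 0" "D \<ge> 0" "gap \<ge> 0" "contraction \<ge> 0"
proof -
  show "Lx \<ge> 0" "Ly \<ge> 0" "LS \<ge> 0" "Lt \<ge> 0"
    using lipschitz_f1 lipschitz_f2 lipschitz_S lipschitz_F init by (auto dest: lipschitz_on_nonneg)
  show "D \<ge> 0" using diam [of y0 y0] init by simp
  show "gap \<ge> 0" using gap [of x0] init by simp
  show "contraction \<ge> 0" using pos by (simp add: contraction_def)
qed

lemma constants_nonneg:
  "first_step \<ge> 0" "speed \<ge> 0" "lag \<ge> 0" "bias \<ge> 0" "drift \<ge> 0" "budget \<ge> 0" "rate \<ge> 0"
proof -
  show 1: "first_step \<ge> 0" using nonneg pos by (simp add: first_step_def)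
  show 2: "speed \<ge> 0" using nonneg pos by (simp add: speed_def)
  show 3: "lag \<ge> 0" using nonneg 1 2 by (simp add: lag_def)
  show 4: "bias \<ge> 0" using nonneg 3 pos by (simp add: bias_def)
  show 5: "drift \<ge> 0" using pos by (simp add: drift_def)
  show 6: "budget \<ge> 0" using nonneg 1 5 by (simp add: budget_def)
  show "rate \<ge> 0" using nonneg 6 pos by (simp add: rate_def)
qed

lemma decay_bounds: "0 < decay t" "decay t \<le> 1"
  using powr_mono2' [of "- 1 / 4" 1 "real t + 1"] by (auto simp: decay_def)

lemma decay_squared: "(decay t)\<^sup>2 = 1 / sqrt (real t + 1)"
  by (simp add: decay_def power2_eq_square powr_add [symmetric] powr_minus powr_half_sqrt field_simps)

lemma decay_fourth: "(decay t) ^ 4 = 1 / (real t + 1)"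
proof -
  have "(decay t) ^ 4 = ((decay t)\<^sup>2)\<^sup>2" by (simp flip: power_mult)
  then show ?thesis by (simp add: decay_squared power_divide)
qed

lemma decay_squared_Suc: "(decay t)\<^sup>2 \<le> 2 * (decay (Suc t))\<^sup>2"
proof -
  have "sqrt (real (Suc t) + 1) \<le> sqrt (4 * (real t + 1))"
    by (rule real_sqrt_le_mono) simp
  also have "\<dots> = 2 * sqrt (real t + 1)"
    by (simp only: real_sqrt_mult real_sqrt_four)
  finally show ?thesis
    by (simp add: decay_squared field_simps)
qed

lemma eta_eq: "eta t = etabar * (decay t)\<^sup>2 / real d"
  by (simp add: eta_def decay_def power2_eq_square powr_add [symmetric] powr_minus field_simps)

lemma delta_eq: "delta t = deltabar * decay t / sqrt (real d)"
  by (simp add: delta_def decay_def powr_minus powr_half_sqrt field_simps)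

lemma eta_pos: "eta t > 0" and delta_pos: "delta t > 0"
  using decay_bounds [of t] pos dTK by (auto simp: eta_eq delta_eq)

lemma delta_le: "delta t \<le> deltabar * decay t"
proof -
  have "deltabar * decay t / sqrt (real d) \<le> deltabar * decay t / 1"
    using decay_bounds [of t] pos dTK by (intro divide_left_mono) auto
  then show ?thesis by (simp add: delta_eq)
qed

lemma contraction_squared_le: "contraction\<^sup>2 \<le> C3 / (sqrt (real T) * (real d)\<^sup>2)"
proof -
  have "real K powr (- lam) \<le> (real T powr (1 / (2 * lam)) * real d powr (2 / lam)) powr (- lam)"
    using K_ge pos dTK by (intro powr_mono2') auto
  also have "\<dots> = real T powr (- 1 / 2) * real d powr (- 2)"
    using pos dTK by (simp add: powr_mult powr_powr)
  also have "\<dots> = 1 / (sqrt (real T) * (real d)\<^sup>2)"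
    using dTK by (simp add: powr_minus powr_half_sqrt field_simps)
  finally have "C3 * real K powr (- lam) \<le> C3 * (1 / (sqrt (real T) * (real d)\<^sup>2))"
    using pos by (intro mult_left_mono) auto
  then show ?thesis
    using pos by (simp add: contraction_def)
qed

text \<open>
  The lower bound on \<open>K\<close> is tied to the horizon \<open>T\<close>; only its weaker form with \<open>t + 1\<close> in place of \<open>T\<close>
  enters the error at time \<open>t\<close>.
\<close>

lemma contraction_le:
  assumes "t < T"
  shows "contraction \<le> sqrt C3 * decay t / real d"
proof (rule power2_le_imp_le)
  have "contraction\<^sup>2 \<le> C3 / (sqrt (real T) * (real d)\<^sup>2)"
    by (rule contraction_squared_le)
  also have "\<dots> \<le> C3 / (sqrt (real t + 1) * (real d)\<^sup>2)"
    using pos assms dTK by (intro divide_left_mono mult_right_mono) auto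
  also have "\<dots> = (sqrt C3 * decay t / real d)\<^sup>2"
    using pos by (simp add: power_divide power_mult_distrib decay_squared)
  finally show "contraction\<^sup>2 \<le> (sqrt C3 * decay t / real d)\<^sup>2" .
  show "0 \<le> sqrt C3 * decay t / real d"
    using decay_bounds [of t] pos by simp
qed

lemma contraction_le_quarter:
  assumes "sqrt (real T) \<ge> 16 * C3"
  shows "contraction \<le> 1 / 4"
proof (rule power2_le_imp_le)
  have "sqrt (real T) * 1 \<le> sqrt (real T) * (real d)\<^sup>2"
    using dTK by (intro mult_left_mono) auto
  then have "16 * C3 \<le> sqrt (real T) * (real d)\<^sup>2"
    using assms by simp
  then have "C3 / (sqrt (real T) * (real d)\<^sup>2) \<le> 1 / 16"
    using dTK by (simp add: divide_le_eq)
  moreover have "(1 / 4 :: real)\<^sup>2 = 1 / 16"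
    by (simp add: power2_eq_square)
  ultimately show "contraction\<^sup>2 \<le> (1 / 4)\<^sup>2"
    using contraction_squared_le by linarith
qed simp

lemma follower_error:
  assumes "x \<in> Rn d" "y \<in> Y"
  shows "norm (follower H x y K - S x) \<le> contraction * norm (y - S x)"
proof (rule power2_le_imp_le)
  have "(norm (follower H x y K - S x))\<^sup>2 \<le> C3 * real K powr (- lam) * (norm (y - S x))\<^sup>2"
    using A3 assms dTK by (auto simp: assumption_A3_1a_def)
  then show "(norm (follower H x y K - S x))\<^sup>2 \<le> (contraction * norm (y - S x))\<^sup>2"
    using pos by (simp add: contraction_def power_mult_distrib)
qed (use nonneg in simp)

definition x :: "(nat \<Rightarrow> rvec) \<Rightarrow> nat \<Rightarrow> rvec" where
  "x v t = fst (two_loop d K f H eta delta v (x0, y0, y0') t)"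

text \<open>
  \<open>y\<close> and \<open>w\<close> are the initialisations of the follower loops at the perturbed and at the unperturbed point.
  They agree except possibly at time \<open>0\<close>.
\<close>

definition y :: "(nat \<Rightarrow> rvec) \<Rightarrow> nat \<Rightarrow> real ^ 'm" where
  "y v t = fst (snd (two_loop d K f H eta delta v (x0, y0, y0') t))"

definition w :: "(nat \<Rightarrow> rvec) \<Rightarrow> nat \<Rightarrow> real ^ 'm" where
  "w v t = snd (snd (two_loop d K f H eta delta v (x0, y0, y0') t))"

definition probe :: "(nat \<Rightarrow> rvec) \<Rightarrow> nat \<Rightarrow> rvec" where
  "probe v t = x v t + delta t *\<^sub>R v t"

definition increment :: "(nat \<Rightarrow> rvec) \<Rightarrow> nat \<Rightarrow> real" where
  "increment v t = f (probe v t) (follower H (probe v t) (y v t) K) - f (x v t) (follower H (x v t) (w v t) K)"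

lemma two_loop_0: "x v 0 = x0" "y v 0 = y0" "w v 0 = y0'"
  by (simp_all add: x_def y_def w_def)

lemma two_loop_Suc:
  "x v (Suc t) = x v t - (eta t * (real d / delta t) * increment v t) *\<^sub>R v t"
  "y v (Suc t) = follower H (x v t) (w v t) K"
  "w v (Suc t) = follower H (x v t) (w v t) K"
  by (simp_all add: x_def y_def w_def probe_def increment_def Let_def split: prod.splits)

section \<open>The pathwise descent inequality\<close>

context
  fixes v :: "nat \<Rightarrow> rvec"
  assumes dirs: "\<And>t. v t \<in> unit_dirs d"
begin

lemma v_in_Rn: "v t \<in> Rn d" and norm_v: "norm (v t) = 1"
  using dirs [of t] by (auto simp: unit_dirs_def)

lemma iterates_in: "x v t \<in> Rn d \<and> y v t \<in> Y \<and> w v t \<in> Y"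
  by (induction t) (auto simp: two_loop_0 two_loop_Suc init v_in_Rn intro!: Rn_ops follower_in_Y)

lemmas x_in = iterates_in [THEN conjunct1]
lemmas y_in = iterates_in [THEN conjunct2, THEN conjunct1]
lemmas w_in = iterates_in [THEN conjunct2, THEN conjunct2]

lemma probe_in: "probe v t \<in> Rn d"
  by (simp add: probe_def Rn_ops x_in v_in_Rn)

lemma norm_probe_diff: "norm (probe v t - x v t) = delta t"
  using delta_pos [of t] by (simp add: probe_def norm_v)

lemma norm_step: "norm (x v (Suc t) - x v t) = eta t * real d * (\<bar>increment v t\<bar> / delta t)"
  using delta_pos [of t] eta_pos [of t] by (simp add: two_loop_Suc norm_v abs_mult)

lemma abs_f_diff_le: "z \<in> Rn d \<Longrightarrow> u \<in> Y \<Longrightarrow> u' \<in> Y \<Longrightarrow> \<bar>f z u - f z u'\<bar> \<le> Ly * norm (u - u')"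
  using lipschitz_onD [OF lipschitz_f2] by (auto simp: dist_norm)

text \<open>
  Followers that were at equilibrium would make the observed increment that of the hyper-objective; the
  deviation is Lipschitz in what is left of the initial errors after \<open>K\<close> updates.
\<close>

lemma increment_residual:
  "\<bar>increment v t - (F (probe v t) - F (x v t))\<bar>
    \<le> Ly * (contraction * (norm (y v t - S (probe v t)) + norm (w v t - S (x v t))))"
proof -
  let ?y = "follower H (probe v t) (y v t) K" and ?w = "follower H (x v t) (w v t) K"
  have "\<bar>increment v t - (F (probe v t) - F (x v t))\<bar>
      \<le> \<bar>f (probe v t) ?y - f (probe v t) (S (probe v t))\<bar> + \<bar>f (x v t) ?w - f (x v t) (S (x v t))\<bar>"
    by (simp add: increment_def hyper_objective_def)
  also have "\<dots> \<le> Ly * norm (?y - S (probe v t)) + Ly * norm (?w - S (x v t))"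
    by (intro add_mono abs_f_diff_le probe_in x_in follower_in_Y y_in w_in S_in_Y)
  also have "\<dots> \<le> Ly * (contraction * norm (y v t - S (probe v t))) + Ly * (contraction * norm (w v t - S (x v t)))"
    using nonneg by (intro add_mono mult_left_mono follower_error probe_in x_in y_in w_in)
  finally show ?thesis by (simp add: algebra_simps)
qed

text \<open>
  From the second iteration on both follower loops start from the same point, so by (A2) their outcomes
  differ by at most \<open>C2\<close> times the perturbation radius, which the step size divides out.
\<close>

lemma step_le_Suc: "norm (x v (Suc (Suc t)) - x v (Suc t)) \<le> speed * (decay (Suc t))\<^sup>2"
proof -
  let ?t = "Suc t"
  let ?y = "follower H (probe v ?t) (y v ?t) K" and ?w = "follower H (x v ?t) (w v ?t) K"
  have same: "y v ?t = w v ?t" by (simp add: two_loop_Suc)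
  have "\<bar>increment v ?t\<bar> \<le> \<bar>f (probe v ?t) ?y - f (x v ?t) ?y\<bar> + \<bar>f (x v ?t) ?y - f (x v ?t) ?w\<bar>"
    by (simp add: increment_def)
  also have "\<bar>f (probe v ?t) ?y - f (x v ?t) ?y\<bar> \<le> Lx * delta ?t"
    using lipschitz_onD [OF lipschitz_f1 probe_in x_in, of ?y ?t ?t] follower_in_Y probe_in y_in
    by (simp add: dist_norm norm_probe_diff)
  also have "\<bar>f (x v ?t) ?y - f (x v ?t) ?w\<bar> \<le> Ly * norm (?y - ?w)"
    by (intro abs_f_diff_le probe_in x_in follower_in_Y y_in w_in)
  also have "norm (?y - ?w) \<le> C2 * delta ?t"
    using A2 w_in [of ?t] probe_in [of ?t] x_in [of ?t]
    unfolding assumption_A2_def same norm_probe_diff [of ?t, symmetric] by blast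
  finally have "\<bar>increment v ?t\<bar> \<le> Lx * delta ?t + Ly * (C2 * delta ?t)"
    using nonneg by (simp add: mult_left_mono)
  then have "\<bar>increment v ?t\<bar> / delta ?t \<le> Lx + Ly * C2"
    using delta_pos [of ?t] by (simp add: divide_le_eq algebra_simps)
  then have "eta ?t * real d * (\<bar>increment v ?t\<bar> / delta ?t) \<le> eta ?t * real d * (Lx + Ly * C2)"
    using eta_pos [of ?t] by (intro mult_left_mono) auto
  also have "\<dots> = speed * (decay ?t)\<^sup>2"
    using dTK by (simp add: eta_eq speed_def)
  finally show ?thesis by (simp add: norm_step)
qed

text \<open>
  At time \<open>0\<close> the two loops may start from different points, whereas (A2) compares runs from a common one.
  The increment is therefore compared with that of the hyper-objective: the follower errors are of order \<open>1 / d\<close> by the choice of \<open>K\<close>, which outweighs the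
  factor \<open>sqrt d\<close> from the division by the radius.
\<close>

lemma first_step_le: "norm (x v 1 - x v 0) \<le> first_step"
proof -
  have sqrt_d: "sqrt (real d) \<le> real d" "sqrt (real d) > 0"
    using dTK by (auto intro: real_le_lsqrt simp: power2_eq_square)
  \<comment> \<open>Nothing better than the diameter of \<open>Y\<close> is known about the initial errors.\<close>
  have "norm (y v 0 - S (probe v 0)) + norm (w v 0 - S (x v 0)) \<le> D + D"
    by (intro add_mono diam y_in w_in S_in_Y probe_in x_in)
  then have "Ly * (contraction * (norm (y v 0 - S (probe v 0)) + norm (w v 0 - S (x v 0))))
      \<le> Ly * (contraction * (D + D))"
    using nonneg by (intro mult_left_mono) auto
  moreover have "\<bar>F (probe v 0) - F (x v 0)\<bar> \<le> Lt * delta 0"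
    using lipschitz_onD [OF lipschitz_F probe_in x_in, of 0 0] by (simp add: dist_norm norm_probe_diff)
  ultimately have "\<bar>increment v 0\<bar> \<le> Lt * delta 0 + 2 * Ly * D * contraction"
    using increment_residual [of 0] by (simp add: algebra_simps)
  also have "contraction \<le> sqrt C3 * decay 0 / real d"
    using dTK by (intro contraction_le) simp
  also have "\<dots> \<le> sqrt C3 / sqrt (real d)"
    using sqrt_d pos by (simp add: decay_def frac_le)
  finally have "\<bar>increment v 0\<bar> \<le> Lt * delta 0 + 2 * Ly * D * (sqrt C3 / sqrt (real d))"
    using nonneg by (simp add: mult_left_mono)
  also have "\<dots> = (Lt + 2 * Ly * D * sqrt C3 / deltabar) * delta 0"
    using pos sqrt_d by (simp add: delta_eq decay_def field_simps)
  finally have "\<bar>increment v 0\<bar> / delta 0 \<le> Lt + 2 * Ly * D * sqrt C3 / deltabar"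
    using delta_pos [of 0] by (simp add: pos_divide_le_eq)
  then have "eta 0 * real d * (\<bar>increment v 0\<bar> / delta 0) \<le> eta 0 * real d * (Lt + 2 * Ly * D * sqrt C3 / deltabar)"
    using eta_pos [of 0] by (intro mult_left_mono) auto
  also have "\<dots> = first_step"
    using dTK by (simp add: eta_eq first_step_def decay_def)
  finally show ?thesis by (simp add: norm_step)
qed

text \<open>
  The followers lose a factor \<open>4\<close> of their error in each iteration and gain at most a displacement of the
  equilibrium.  Since \<open>(t + 1)\<^sup>-\<^sup>1\<^sup>/\<^sup>2\<close> at most halves from one iteration to the next, the error inherits the order
  of the displacements.
\<close>

lemma tracking_error:
  assumes "contraction \<le> 1 / 4"
  shows "norm (w v (Suc t) - S (x v (Suc t))) \<le> lag * (decay (Suc t))\<^sup>2"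
proof -
  have recursion: "norm (w v (Suc t) - S (x v (Suc t)))
      \<le> norm (w v t - S (x v t)) / 4 + LS * norm (x v (Suc t) - x v t)" for t
  proof -
    have "norm (w v (Suc t) - S (x v (Suc t)))
        \<le> norm (w v (Suc t) - S (x v t)) + norm (S (x v (Suc t)) - S (x v t))"
      by norm
    also have "norm (w v (Suc t) - S (x v t)) \<le> contraction * norm (w v t - S (x v t))"
      unfolding two_loop_Suc by (intro follower_error x_in w_in)
    also have "\<dots> \<le> 1 / 4 * norm (w v t - S (x v t))"
      using assms by (intro mult_right_mono) auto
    also have "norm (S (x v (Suc t)) - S (x v t)) \<le> LS * norm (x v (Suc t) - x v t)"
      using lipschitz_onD [OF lipschitz_S x_in x_in] by (simp add: dist_norm)
    finally show ?thesis by simp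
  qed
  show ?thesis
  proof (induction t)
    case 0
    have "norm (w v 1 - S (x v 1)) \<le> D + LS * first_step"
    proof -
      have "norm (w v 0 - S (x v 0)) \<le> D"
        by (intro diam w_in S_in_Y x_in)
      moreover have "LS * norm (x v 1 - x v 0) \<le> LS * first_step"
        using nonneg by (intro mult_left_mono first_step_le)
      ultimately show ?thesis
        using recursion [of 0] nonneg by simp
    qed
    also have "\<dots> \<le> lag / 2"
      using nonneg constants_nonneg by (simp add: lag_def)
    also have "\<dots> \<le> lag * (decay (Suc 0))\<^sup>2"
      using decay_squared_Suc [of 0] constants_nonneg mult_left_mono [of "1 / 2" "(decay (Suc 0))\<^sup>2" lag]
      by (simp add: decay_def)
    finally show ?case by simp
  next
    case (Suc t)
    have "LS * norm (x v (Suc (Suc t)) - x v (Suc t)) \<le> LS * (speed * (decay (Suc t))\<^sup>2)"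
      using nonneg by (intro mult_left_mono step_le_Suc)
    then have "norm (w v (Suc (Suc t)) - S (x v (Suc (Suc t))))
        \<le> lag * (decay (Suc t))\<^sup>2 / 4 + LS * (speed * (decay (Suc t))\<^sup>2)"
      using recursion [of "Suc t"] Suc by simp
    also have "\<dots> = (lag / 4 + LS * speed) * (decay (Suc t))\<^sup>2"
      by (simp add: algebra_simps)
    also have "\<dots> \<le> lag / 2 * (decay (Suc t))\<^sup>2"
      using nonneg constants_nonneg by (intro mult_right_mono) (simp_all add: lag_def)
    also have "\<dots> \<le> lag * (decay (Suc (Suc t)))\<^sup>2"
      using decay_squared_Suc [of "Suc t"] constants_nonneg
        mult_left_mono [of "(decay (Suc t))\<^sup>2" "2 * (decay (Suc (Suc t)))\<^sup>2" lag] by simp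
    finally show ?case .
  qed
qed

text \<open>
  Two errors add up: the curvature of \<open>F\<close> over the perturbation radius, and the follower errors divided by
  that radius.  In the latter a warm-start error of order \<open>s\<^sup>2\<close> over a radius of order \<open>s / sqrt d\<close> is multiplied by a
  contraction factor of order \<open>s / d\<close>.
\<close>

lemma estimator_bias:
  assumes "contraction \<le> 1 / 4" "Suc t < T"
  shows "\<bar>increment v (Suc t) / delta (Suc t) - gradF (x v (Suc t)) \<bullet> v (Suc t)\<bar> \<le> bias * decay (Suc t)"
proof -
  let ?t = "Suc t"
  have sqrt_d: "sqrt (real d) \<le> real d" "sqrt (real d) > 0"
    using dTK by (auto intro: real_le_lsqrt simp: power2_eq_square)
  have \<delta>: "delta ?t > 0" by (rule delta_pos)
  have "\<bar>F (probe v ?t) - F (x v ?t) - delta ?t * (gradF (x v ?t) \<bullet> v ?t)\<bar> \<le> lt * (delta ?t)\<^sup>2"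
    using smooth_on_quadratic_bound [OF smooth_F x_in, of "delta ?t *\<^sub>R v ?t" ?t]
    by (simp add: Rn_ops v_in_Rn norm_v probe_def)
  moreover have "\<bar>increment v ?t - (F (probe v ?t) - F (x v ?t))\<bar> \<le> Ly * (contraction * (2 * (lag * (decay ?t)\<^sup>2) + LS * delta ?t))"
  proof -
    have "norm (y v ?t - S (probe v ?t)) \<le> norm (w v ?t - S (x v ?t)) + norm (S (probe v ?t) - S (x v ?t))"
      unfolding two_loop_Suc by norm
    also have "norm (S (probe v ?t) - S (x v ?t)) \<le> LS * delta ?t"
      using lipschitz_onD [OF lipschitz_S probe_in x_in, of ?t ?t] by (simp add: dist_norm norm_probe_diff)
    finally have "norm (y v ?t - S (probe v ?t)) + norm (w v ?t - S (x v ?t))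
        \<le> 2 * (lag * (decay ?t)\<^sup>2) + LS * delta ?t"
      using tracking_error [OF assms(1), of t] by simp
    then show ?thesis
      using increment_residual [of ?t] nonneg by (meson order_trans mult_left_mono)
  qed
  ultimately have "\<bar>increment v ?t - delta ?t * (gradF (x v ?t) \<bullet> v ?t)\<bar>
      \<le> lt * (delta ?t)\<^sup>2 + Ly * (contraction * (2 * (lag * (decay ?t)\<^sup>2) + LS * delta ?t))"
    by linarith
  also have "\<dots> = (lt * delta ?t + Ly * (contraction * (2 * (lag * (decay ?t)\<^sup>2 / delta ?t) + LS))) * delta ?t"
    using \<delta> by (simp add: field_simps power2_eq_square)
  finally have "\<bar>increment v ?t - delta ?t * (gradF (x v ?t) \<bullet> v ?t)\<bar> / delta ?t
      \<le> lt * delta ?t + Ly * (contraction * (2 * (lag * (decay ?t)\<^sup>2 / delta ?t) + LS))"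
    using \<delta> by (simp add: divide_le_eq)
  also have "\<dots> \<le> lt * (deltabar * decay ?t) + Ly * (sqrt C3 * (2 * lag / deltabar + LS) * decay ?t)"
  proof (intro add_mono mult_left_mono)
    show "contraction * (2 * (lag * (decay ?t)\<^sup>2 / delta ?t) + LS) \<le> sqrt C3 * (2 * lag / deltabar + LS) * decay ?t"
    proof -
      have "contraction * (2 * (lag * (decay ?t)\<^sup>2 / delta ?t) + LS)
          \<le> sqrt C3 * decay ?t / real d * (2 * (lag * (decay ?t)\<^sup>2 / delta ?t) + LS)"
        using nonneg constants_nonneg \<delta> by (intro mult_right_mono contraction_le assms) simp
      also have "\<dots> = sqrt C3 * decay ?t * (2 * lag / deltabar * (decay ?t * (sqrt (real d) / real d)) + LS * (1 / real d))"
        using pos decay_bounds [of ?t] sqrt_d by (simp add: delta_eq field_simps power2_eq_square)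
      also have "\<dots> \<le> sqrt C3 * decay ?t * (2 * lag / deltabar * 1 + LS * 1)"
        using pos decay_bounds [of ?t] sqrt_d dTK nonneg constants_nonneg
        by (intro mult_left_mono add_mono mult_le_one) auto
      finally show ?thesis by (simp add: algebra_simps)
    qed
  qed (use pos nonneg delta_le in auto)
  also have "\<dots> = bias * decay ?t"
    by (simp add: bias_def algebra_simps)
  also have "\<bar>increment v ?t - delta ?t * (gradF (x v ?t) \<bullet> v ?t)\<bar> / delta ?t = \<bar>increment v ?t / delta ?t - gradF (x v ?t) \<bullet> v ?t\<bar>"
    using \<delta> by (simp add: field_simps abs_div_pos [symmetric])
  finally show ?thesis .
qed

text \<open>
  With \<open>a\<close> the directional derivative and \<open>r\<close> its error, first-order expansion gains \<open>c a (a + r)\<close>, and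
  \<open>(a + r)\<^sup>2 \<ge> 0\<close> bounds this from below by \<open>c (a\<^sup>2 - r\<^sup>2) / 2\<close>.
\<close>

lemma descent_step:
  assumes "contraction \<le> 1 / 4" "Suc t < T"
  shows "etabar * (decay (Suc t))\<^sup>2 / 2 * (gradF (x v (Suc t)) \<bullet> v (Suc t))\<^sup>2
    \<le> F (x v (Suc t)) - F (x v (Suc (Suc t))) + drift / (real (Suc t) + 1)"
proof -
  let ?t = "Suc t"
  define a where "a = gradF (x v ?t) \<bullet> v ?t"
  define r where "r = increment v ?t / delta ?t - a"
  define c where "c = etabar * (decay ?t)\<^sup>2"
  have c: "c > 0" using pos decay_bounds [of ?t] by (simp add: c_def)
  have r: "\<bar>r\<bar> \<le> bias * decay ?t"
    using estimator_bias [OF assms] by (simp add: r_def a_def)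
  \<comment> \<open>The factor \<open>d\<close> of the estimator cancels against the step size, so that the step is \<open>u\<close>.\<close>
  define u where "u = (- c * (a + r)) *\<^sub>R v ?t"
  have u: "u \<in> Rn d"
    unfolding u_def by (intro Rn_ops v_in_Rn)
  have step: "x v (Suc ?t) = x v ?t + u"
    using dTK by (simp add: two_loop_Suc u_def c_def r_def eta_eq)
  have "F (x v (Suc ?t)) - F (x v ?t) \<le> gradF (x v ?t) \<bullet> u + lt * (norm u)\<^sup>2"
    using smooth_on_quadratic_bound [OF smooth_F x_in u, of ?t] unfolding step by linarith
  also have "gradF (x v ?t) \<bullet> u = - c * (a * (a + r))"
    by (simp add: a_def u_def)
  also have "norm u = norm (x v (Suc ?t) - x v ?t)"
    by (simp add: step)
  also have "(norm (x v (Suc ?t) - x v ?t))\<^sup>2 \<le> (speed * (decay ?t)\<^sup>2)\<^sup>2"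
    by (intro power_mono step_le_Suc) simp
  finally have "F (x v (Suc ?t)) - F (x v ?t) \<le> - c * (a * (a + r)) + lt * (speed * (decay ?t)\<^sup>2)\<^sup>2"
    using pos by simp
  also have "- c * (a * (a + r)) \<le> - c * (a\<^sup>2 / 2 - (bias * decay ?t)\<^sup>2 / 2)"
  proof -
    have "0 \<le> (a + r)\<^sup>2" by simp
    moreover have "r\<^sup>2 \<le> (bias * decay ?t)\<^sup>2"
      using r power_mono [of "\<bar>r\<bar>" "bias * decay ?t" 2] by simp
    ultimately have "a\<^sup>2 / 2 - (bias * decay ?t)\<^sup>2 / 2 \<le> a * (a + r)"
      by (simp add: power2_sum algebra_simps power2_eq_square)
    then show ?thesis using c by simp
  qed
  finally have "c / 2 * a\<^sup>2 \<le> F (x v ?t) - F (x v (Suc ?t))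
      + (c * (bias * decay ?t)\<^sup>2 / 2 + lt * (speed * (decay ?t)\<^sup>2)\<^sup>2)"
    by (simp add: algebra_simps)
  also have "c * (bias * decay ?t)\<^sup>2 / 2 + lt * (speed * (decay ?t)\<^sup>2)\<^sup>2 = drift * decay ?t ^ 4"
    by (simp add: drift_def c_def power_mult_distrib algebra_simps flip: power_add power_mult)
  finally show ?thesis
    by (simp add: decay_fourth a_def c_def)
qed

lemma sum_directional_derivatives:
  assumes "contraction \<le> 1 / 4"
  shows "(\<Sum>t<T - 1. etabar * (decay (Suc t))\<^sup>2 / 2 * (gradF (x v (Suc t)) \<bullet> v (Suc t))\<^sup>2)
    \<le> budget * (1 + ln (real T))"
proof -
  have "(\<Sum>t<T - 1. etabar * (decay (Suc t))\<^sup>2 / 2 * (gradF (x v (Suc t)) \<bullet> v (Suc t))\<^sup>2)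
      \<le> (\<Sum>t<T - 1. (F (x v (Suc t)) - F (x v (Suc (Suc t)))) + drift * (1 / (real (Suc t) + 1)))"
    using descent_step [OF assms] by (intro sum_mono) simp
  also have "\<dots> = F (x v 1) - F (x v T) + drift * (\<Sum>t<T - 1. 1 / (real (Suc t) + 1))"
    using sum_lessThan_telescope' [of "\<lambda>t. F (x v (Suc t))" "T - 1"] dTK
    by (simp add: sum.distrib sum_distrib_left)
  also have "\<dots> \<le> F (x v 1) - F (x v T) + drift * ln (real T)"
    using sum_inverse_le_ln [of "T - 1"] dTK constants_nonneg by (simp add: mult_left_mono)
  also have "F (x v 1) - F (x v T) \<le> Lt * first_step + gap"
  proof -
    have "\<bar>F (x v 1) - F (x v 0)\<bar> \<le> Lt * norm (x v 1 - x v 0)"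
      using lipschitz_onD [OF lipschitz_F x_in x_in, of 1 0] by (simp add: dist_norm)
    also have "\<dots> \<le> Lt * first_step"
      using nonneg by (intro mult_left_mono first_step_le)
    finally show ?thesis
      using gap [OF x_in, of T] by (simp add: two_loop_0)
  qed
  also have "Lt * first_step + gap + drift * ln (real T) \<le> budget * (1 + ln (real T))"
  proof -
    have "0 \<le> (Lt * first_step + gap) * ln (real T)"
      using nonneg constants_nonneg dTK by simp
    then show ?thesis
      using constants_nonneg by (simp add: budget_def algebra_simps)
  qed
  finally show ?thesis by simp
qed

end
end

section \<open>Measurability and dependence on the past\<close>

text \<open>
  The directions lie on the sphere only almost surely, and nothing is known about \<open>f\<close> and \<open>H\<close> when an
  iterate leaves \<open>Rn d\<close>.  Clipping changes the directions on a null set and makes the pathwise analysis apply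
  everywhere.
\<close>

definition clip :: "nat \<Rightarrow> rvec \<Rightarrow> rvec" where
  "clip d u = (if u \<in> unit_dirs d then u else unit_coord 0)"

lemma clip_in_unit_dirs: "d \<ge> 1 \<Longrightarrow> clip d u \<in> unit_dirs d"
  by (simp add: clip_def unit_dirs_def unit_coord_in_Rn norm_unit_coord)

lemma clip_id: "u \<in> unit_dirs d \<Longrightarrow> clip d u = u"
  by (simp add: clip_def)

lemma measurable_clip [measurable]: "clip d \<in> borel \<rightarrow>\<^sub>M borel"
  unfolding clip_def [abs_def] using unit_dirs_borel [of d] by (intro measurable_If_set) auto

lemma integral_coord_mult_clip_unif_sphere:
  assumes "i < d" "j < d"
  shows "(\<integral>u. coord (clip d u) i * coord (clip d u) j \<partial>unif_sphere d) = (if i = j then 1 / real d else 0)"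
proof -
  have sets_S [measurable_cong]: "sets (unif_sphere d) = sets borel"
    by (simp add: unif_sphere_def)
  have "(\<integral>u. coord (clip d u) i * coord (clip d u) j \<partial>unif_sphere d) = (\<integral>u. coord u i * coord u j \<partial>unif_sphere d)"
  proof (rule integral_cong_AE)
    show "AE u in unif_sphere d. coord (clip d u) i * coord (clip d u) j = coord u i * coord u j"
    proof -
      have "d \<ge> 1" using assms by simp
      from AE_unif_sphere_unit_dirs [OF this] show ?thesis
        by eventually_elim (simp add: clip_id)
    qed
  qed measurable
  then show ?thesis
    by (simp only: integral_coord_mult_unif_sphere [OF assms])
qed

lemma two_loop_cong:
  assumes "\<And>s. s < t \<Longrightarrow> v s = v' s"
  shows "two_loop d K f H \<eta> \<delta> v init t = two_loop d K f H \<eta> \<delta> v' init t"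
  using assms by (induction t) (auto simp: Let_def split: prod.splits)

context two_loop_game
begin

lemma measurable_follower:
  assumes "a \<in> borel_measurable N" "b \<in> borel_measurable N"
    and "\<And>c. a c \<in> Rn d" "\<And>c. b c \<in> Y"
  shows "(\<lambda>c. follower H (a c) (b c) k) \<in> borel_measurable N"
proof (induction k)
  case (Suc k)
  have "(\<lambda>c. (follower H (a c) (b c) k, a c)) \<in> N \<rightarrow>\<^sub>M restrict_space borel (Y \<times> Rn d)"
    using assms Suc by (intro measurable_restrict_space2 borel_measurable_Pair) (auto intro: follower_in_Y)
  moreover have "(\<lambda>(y, x). H k y x) \<in> borel_measurable (restrict_space borel (Y \<times> Rn d))"
    using updates by (simp add: update_maps_def)
  ultimately have "(\<lambda>(y, x). H k y x) \<circ> (\<lambda>c. (follower H (a c) (b c) k, a c)) \<in> borel_measurable N"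
    by (rule measurable_comp)
  then show ?case by (simp add: comp_def)
qed (use assms in simp)

lemma measurable_f:
  assumes "a \<in> borel_measurable N" "b \<in> borel_measurable N"
    and "\<And>c. a c \<in> Rn d" "\<And>c. b c \<in> Y"
  shows "(\<lambda>c. f (a c) (b c)) \<in> borel_measurable N"
proof -
  have "continuous_on (Rn d \<times> Y) (\<lambda>(x, y). f x y)"
  proof -
    obtain f' where "\<forall>z\<in>Rn d \<times> Y.
        ((\<lambda>(x, y). f x y) has_derivative blinfun_apply (f' z)) (at z within Rn d \<times> Y)"
      using C2_f unfolding C2_on_def by blast
    then show ?thesis
      by (intro has_derivative_continuous_on) auto
  qed
  then have "(\<lambda>(x, y). f x y) \<in> borel_measurable (restrict_space borel (Rn d \<times> Y))"
    by (rule borel_measurable_continuous_on_restrict)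
  moreover have "(\<lambda>c. (a c, b c)) \<in> N \<rightarrow>\<^sub>M restrict_space borel (Rn d \<times> Y)"
    using assms by (intro measurable_restrict_space2 borel_measurable_Pair) auto
  ultimately have "(\<lambda>(x, y). f x y) \<circ> (\<lambda>c. (a c, b c)) \<in> borel_measurable N"
    by (intro measurable_comp)
  then show ?thesis by (simp add: comp_def)
qed

text \<open>
  Only directions before time \<open>t\<close> have to be measurable.  This allows \<open>N\<close> to be the product space of the
  past directions.
\<close>

lemma measurable_iterates:
  assumes "\<And>s. s < t \<Longrightarrow> V s \<in> borel_measurable N"
    and V: "\<And>s c. V s c \<in> unit_dirs d"
  shows "(\<lambda>c. x (\<lambda>s. V s c) t) \<in> borel_measurable N \<and>
    (\<lambda>c. y (\<lambda>s. V s c) t) \<in> borel_measurable N \<and> (\<lambda>c. w (\<lambda>s. V s c) t) \<in> borel_measurable N"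
  using assms(1)
proof (induction t)
  case 0
  then show ?case by (simp add: two_loop_0)
next
  case (Suc t)
  note [measurable] = Suc.prems [of t, simplified]
  from Suc have [measurable]: "(\<lambda>c. x (\<lambda>s. V s c) t) \<in> borel_measurable N"
    "(\<lambda>c. y (\<lambda>s. V s c) t) \<in> borel_measurable N" "(\<lambda>c. w (\<lambda>s. V s c) t) \<in> borel_measurable N"
    by auto
  note mem = x_in [OF V] y_in [OF V] w_in [OF V] probe_in [OF V]
  have probe [measurable]: "(\<lambda>c. probe (\<lambda>s. V s c) t) \<in> borel_measurable N"
    unfolding probe_def by measurable
  have [measurable]: "(\<lambda>c. follower H (x (\<lambda>s. V s c) t) (w (\<lambda>s. V s c) t) K) \<in> borel_measurable N"
    by (intro measurable_follower mem) measurable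
  have [measurable]: "(\<lambda>c. follower H (probe (\<lambda>s. V s c) t) (y (\<lambda>s. V s c) t) K) \<in> borel_measurable N"
    by (intro measurable_follower mem) measurable
  have [measurable]: "(\<lambda>c. increment (\<lambda>s. V s c) t) \<in> borel_measurable N"
    unfolding increment_def by (intro borel_measurable_diff measurable_f mem follower_in_Y) measurable
  show ?case
    unfolding two_loop_Suc by (intro conjI) measurable
qed

lemma measurable_coord_gradF:
  assumes "a \<in> borel_measurable N" "\<And>c. a c \<in> Rn d"
  shows "(\<lambda>c. coord (gradF (a c)) i) \<in> borel_measurable N"
proof -
  have "lt-lipschitz_on (Rn d) gradF"
    using smooth_F by (simp add: smooth_on_def)
  then have "continuous_on (Rn d) (\<lambda>z. coord (gradF z) i)"
    by (intro continuous_on_coord lipschitz_on_continuous_on)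
  then have "(\<lambda>z. coord (gradF z) i) \<in> borel_measurable (restrict_space borel (Rn d))"
    by (rule borel_measurable_continuous_on_restrict)
  moreover have "a \<in> N \<rightarrow>\<^sub>M restrict_space borel (Rn d)"
    using assms by (intro measurable_restrict_space2) auto
  ultimately have "(\<lambda>z. coord (gradF z) i) \<circ> a \<in> borel_measurable N"
    by (intro measurable_comp)
  then show ?thesis by (simp add: comp_def)
qed

lemma gradF_in: "z \<in> Rn d \<Longrightarrow> gradF z \<in> Rn d"
  using smooth_F by (intro grad_Rn) (auto simp: smooth_on_def)

lemma norm_gradF_le: "z \<in> Rn d \<Longrightarrow> norm (gradF z) \<le> 2 * Lt"
  using norm_grad_le [OF smooth_F lipschitz_F] pos by auto

lemma norm_gradF_squared: "z \<in> Rn d \<Longrightarrow> (norm (gradF z))\<^sup>2 = (\<Sum>i<d. (coord (gradF z) i)\<^sup>2)"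
  unfolding power2_norm_eq_inner
  by (subst inner_Rn [OF gradF_in]) (auto simp: power2_eq_square)

context
  fixes P :: "'w measure" and v :: "nat \<Rightarrow> 'w \<Rightarrow> rvec"
  assumes iid: "iid_unif_sphere P d T v"
begin

interpretation P: prob_space P
  using iid by (simp add: iid_unif_sphere_def)

lemma v_measurable: "t < T \<Longrightarrow> v t \<in> borel_measurable P"
  using iid by (auto simp: iid_unif_sphere_def P.indep_vars_def)

definition vc :: "'w \<Rightarrow> nat \<Rightarrow> rvec" where
  "vc \<omega> s = clip d (v s \<omega>)"

lemma vc_dirs: "vc \<omega> s \<in> unit_dirs d"
  using dTK by (simp add: vc_def clip_in_unit_dirs)

lemma vc_measurable: "t < T \<Longrightarrow> (\<lambda>\<omega>. vc \<omega> t) \<in> borel_measurable P"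
  unfolding vc_def using v_measurable by measurable

lemma x_vc_measurable: "t \<le> T \<Longrightarrow> (\<lambda>\<omega>. x (vc \<omega>) t) \<in> borel_measurable P"
  using measurable_iterates [of t "\<lambda>s \<omega>. vc \<omega> s" P] vc_measurable vc_dirs by auto

lemma x_vc_in: "x (vc \<omega>) t \<in> Rn d"
  by (intro x_in vc_dirs)

text \<open>
  Expanding the square into products of coordinates separates the gradient, a function of the past
  directions, from the current direction.  Independence factors each expectation, and the covariance of the
  sphere retains only the diagonal.
\<close>

lemma second_moment_direction:
  assumes "t < T"
  shows "integrable P (\<lambda>\<omega>. (gradF (x (vc \<omega>) t) \<bullet> vc \<omega> t)\<^sup>2)"
    and "P.expectation (\<lambda>\<omega>. (gradF (x (vc \<omega>) t) \<bullet> vc \<omega> t)\<^sup>2)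
      = P.expectation (\<lambda>\<omega>. (norm (gradF (x (vc \<omega>) t)))\<^sup>2) / real d"
proof -
  define g where "g i \<omega> = coord (gradF (x (vc \<omega>) t)) i" for i \<omega>
  define u where "u i \<omega> = coord (vc \<omega> t) i" for i \<omega>
  have g_m [measurable]: "g i \<in> borel_measurable P" for i
    unfolding g_def [abs_def] using assms by (intro measurable_coord_gradF x_vc_measurable x_vc_in) simp
  have u_m [measurable]: "u i \<in> borel_measurable P" for i
    unfolding u_def [abs_def] using vc_measurable [OF assms] by measurable
  have g_le: "\<bar>g i \<omega>\<bar> \<le> 2 * Lt" for i \<omega>
    using abs_coord_le_norm norm_gradF_le [OF x_vc_in] by (force simp: g_def intro: order_trans)
  have u_le: "\<bar>u i \<omega>\<bar> \<le> 1" for i \<omega>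
    using abs_coord_le_norm [of "vc \<omega> t" i] vc_dirs [of \<omega> t] by (simp add: u_def unit_dirs_def)
  have g_int: "integrable P (\<lambda>\<omega>. g i \<omega> * g j \<omega>)" for i j
  proof (rule P.integrable_const_bound)
    show "AE \<omega> in P. norm (g i \<omega> * g j \<omega>) \<le> (2 * Lt) * (2 * Lt)"
      unfolding real_norm_def abs_mult using nonneg by (intro AE_I2 mult_mono g_le) auto
  qed measurable
  have u_int: "integrable P (\<lambda>\<omega>. u i \<omega> * u j \<omega>)" for i j
    using u_le by (intro P.integrable_const_bound [where B = "1 * 1"])
      (auto simp: abs_mult intro!: AE_I2 mult_le_one)
  have u_mean: "P.expectation (\<lambda>\<omega>. u i \<omega> * u j \<omega>) = (if i = j then 1 / real d else 0)" if "i < d" "j < d" for i j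
  proof -
    have "P.expectation (\<lambda>\<omega>. u i \<omega> * u j \<omega>)
        = (\<integral>z. coord (clip d z) i * coord (clip d z) j \<partial>distr P borel (v t))"
      using v_measurable [OF assms] by (subst integral_distr) (auto simp: u_def vc_def)
    also have "distr P borel (v t) = unif_sphere d"
      using iid assms by (simp add: iid_unif_sphere_def)
    finally show ?thesis
      using integral_coord_mult_clip_unif_sphere [OF that] by simp
  qed
  have indep: "P.indep_var borel (\<lambda>\<omega>. g i \<omega> * g j \<omega>) borel (\<lambda>\<omega>. u i \<omega> * u j \<omega>)" for i j
  proof -
    let ?past = "Pi\<^sub>M {..<t} (\<lambda>_. borel :: rvec measure)" and ?now = "Pi\<^sub>M {t} (\<lambda>_. borel :: rvec measure)"
    let ?x = "\<lambda>c. x (\<lambda>s. clip d (c s)) t"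
    have "P.indep_vars (\<lambda>_. borel) v {..<T}"
      using iid by (simp add: iid_unif_sphere_def)
    then have 1: "P.indep_var ?past (\<lambda>\<omega>. restrict (\<lambda>s. v s \<omega>) {..<t}) ?now (\<lambda>\<omega>. restrict (\<lambda>s. v s \<omega>) {t})"
      using assms by (intro P.indep_var_restrict) auto
    have x_m: "?x \<in> borel_measurable ?past"
    proof -
      have "(\<lambda>c. clip d (c s)) \<in> borel_measurable ?past" if "s < t" for s
        using that
        by (intro measurable_compose [OF measurable_component_singleton [where M = "\<lambda>_. borel"] measurable_clip]) auto
      then show ?thesis
        using measurable_iterates [of t "\<lambda>s c. clip d (c s)" ?past] dTK clip_in_unit_dirs by auto
    qed
    have x_Rn: "?x c \<in> Rn d" for c
      using dTK by (intro x_in clip_in_unit_dirs)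
    have 2: "(\<lambda>c. coord (gradF (?x c)) i * coord (gradF (?x c)) j) \<in> borel_measurable ?past"
      by (intro borel_measurable_times measurable_coord_gradF x_m x_Rn)
    have 3: "(\<lambda>c. coord (clip d (c t)) i * coord (clip d (c t)) j) \<in> borel_measurable ?now"
      by measurable
    \<comment> \<open>The iterate at time \<open>t\<close> is a function of the directions before \<open>t\<close>.\<close>
    have past: "?x (restrict (\<lambda>s. v s \<omega>) {..<t}) = x (vc \<omega>) t" for \<omega>
      unfolding x_def by (intro arg_cong [of _ _ fst] two_loop_cong) (simp add: vc_def)
    show ?thesis
      using P.indep_var_compose [OF 1 2 3]
      unfolding comp_def past by (simp add: g_def u_def vc_def)
  qed
  have prod_int: "integrable P (\<lambda>\<omega>. (g i \<omega> * g j \<omega>) * (u i \<omega> * u j \<omega>))" for i j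
    by (intro P.indep_var_integrable indep g_int u_int)
  have expand: "(gradF (x (vc \<omega>) t) \<bullet> vc \<omega> t)\<^sup>2 = (\<Sum>i<d. \<Sum>j<d. (g i \<omega> * g j \<omega>) * (u i \<omega> * u j \<omega>))" for \<omega>
    by (simp add: inner_Rn [OF gradF_in [OF x_vc_in]] power2_eq_square sum_product g_def u_def mult_ac)
  show "integrable P (\<lambda>\<omega>. (gradF (x (vc \<omega>) t) \<bullet> vc \<omega> t)\<^sup>2)"
    unfolding expand by (intro Bochner_Integration.integrable_sum prod_int)
  have "P.expectation (\<lambda>\<omega>. (gradF (x (vc \<omega>) t) \<bullet> vc \<omega> t)\<^sup>2)
      = (\<Sum>i<d. \<Sum>j<d. P.expectation (\<lambda>\<omega>. (g i \<omega> * g j \<omega>) * (u i \<omega> * u j \<omega>)))"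
    unfolding expand using prod_int
    by (subst Bochner_Integration.integral_sum, intro Bochner_Integration.integrable_sum prod_int)
       (simp add: Bochner_Integration.integral_sum)
  also have "\<dots> = (\<Sum>i<d. \<Sum>j<d. P.expectation (\<lambda>\<omega>. g i \<omega> * g j \<omega>) * (if i = j then 1 / real d else 0))"
    using u_mean by (intro sum.cong refl) (simp add: P.indep_var_lebesgue_integral [OF indep g_int u_int])
  also have "\<dots> = (\<Sum>i<d. P.expectation (\<lambda>\<omega>. g i \<omega> * g i \<omega>)) / real d"
    by (simp add: sum_divide_distrib if_distrib [of "(*) _"] cong: if_cong)
  also have "(\<Sum>i<d. P.expectation (\<lambda>\<omega>. g i \<omega> * g i \<omega>)) = P.expectation (\<lambda>\<omega>. (norm (gradF (x (vc \<omega>) t)))\<^sup>2)"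
    unfolding norm_gradF_squared [OF x_vc_in] g_def [symmetric]
    using g_int by (simp add: power2_eq_square Bochner_Integration.integral_sum)
  finally show "P.expectation (\<lambda>\<omega>. (gradF (x (vc \<omega>) t) \<bullet> vc \<omega> t)\<^sup>2)
      = P.expectation (\<lambda>\<omega>. (norm (gradF (x (vc \<omega>) t)))\<^sup>2) / real d" .
qed

section \<open>The convergence rate\<close>

text \<open>
  For large horizons the weighted sum of the expected squared gradients is at most the pathwise budget, and
  each of the \<open>T - 1\<close> weights is at least \<open>etabar / (2 d sqrt T)\<close>.  For small ones \<open>d / sqrt T\<close> is bounded below, and so
  a bounded gradient suffices.
\<close>

lemma exists_small_gradient:
  "\<exists>t\<in>{0..T}. P.expectation (\<lambda>\<omega>. (norm (gradF (x (vc \<omega>) t)))\<^sup>2)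
      \<le> rate * (1 + ln (real T)) * (real d / sqrt (real T))"
proof (cases "sqrt (real T) \<le> 16 * C3 + 2")
  case True
  have "P.expectation (\<lambda>\<omega>. (norm (gradF (x (vc \<omega>) 0)))\<^sup>2) \<le> (2 * Lt)\<^sup>2"
  proof (rule P.integral_le_const)
    have bound: "(norm (gradF (x (vc \<omega>) 0)))\<^sup>2 \<le> (2 * Lt)\<^sup>2" for \<omega>
      by (intro power_mono norm_gradF_le x_vc_in norm_ge_zero)
    then show "AE \<omega> in P. (norm (gradF (x (vc \<omega>) 0)))\<^sup>2 \<le> (2 * Lt)\<^sup>2"
      by simp
    show "integrable P (\<lambda>\<omega>. (norm (gradF (x (vc \<omega>) 0)))\<^sup>2)"
      by (simp add: two_loop_0)
  qed
  also have "\<dots> \<le> 4 * Lt\<^sup>2 * (16 * C3 + 2) * 1 * (real d / sqrt (real T))"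
  proof -
    have "1 \<le> (16 * C3 + 2) * (real d / sqrt (real T))"
    proof -
      have "sqrt (real T) * 1 \<le> (16 * C3 + 2) * real d"
        using True dTK pos by (intro mult_mono) auto
      then show ?thesis using dTK by (simp add: le_divide_eq)
    qed
    then have "4 * Lt\<^sup>2 * 1 \<le> 4 * Lt\<^sup>2 * ((16 * C3 + 2) * (real d / sqrt (real T)))"
      by (intro mult_left_mono) auto
    then show ?thesis by (simp add: power_mult_distrib)
  qed
  also have "\<dots> \<le> rate * (1 + ln (real T)) * (real d / sqrt (real T))"
    using pos constants_nonneg dTK by (intro mult_right_mono mult_mono) (auto simp: rate_def)
  finally show ?thesis by (intro bexI [of _ 0]) auto
next
  case False
  define E where "E t = P.expectation (\<lambda>\<omega>. (norm (gradF (x (vc \<omega>) t)))\<^sup>2)" for t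
  define B where "B = budget * (1 + ln (real T))"
  define m where "m = Min (E ` {0..T})"
  have m_le: "m \<le> E t" if "t \<le> T" for t
    using that by (auto simp: m_def)
  have m_nonneg: "0 \<le> m"
    unfolding m_def by (subst Min_ge_iff) (auto simp: E_def)
  have "(\<Sum>t<T - 1. etabar * (decay (Suc t))\<^sup>2 / 2 * (E (Suc t) / real d))
      = P.expectation (\<lambda>\<omega>. \<Sum>t<T - 1. etabar * (decay (Suc t))\<^sup>2 / 2 * (gradF (x (vc \<omega>) (Suc t)) \<bullet> vc \<omega> (Suc t))\<^sup>2)"
    using second_moment_direction
    by (subst Bochner_Integration.integral_sum) (auto simp: E_def intro!: sum.cong)
  also have "\<dots> \<le> B"
  proof (rule P.integral_le_const)
    have "contraction \<le> 1 / 4"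
      using False by (intro contraction_le_quarter) simp
    then show "AE \<omega> in P. (\<Sum>t<T - 1. etabar * (decay (Suc t))\<^sup>2 / 2 * (gradF (x (vc \<omega>) (Suc t)) \<bullet> vc \<omega> (Suc t))\<^sup>2) \<le> B"
      unfolding B_def by (intro AE_I2 sum_directional_derivatives vc_dirs)
    show "integrable P (\<lambda>\<omega>. \<Sum>t<T - 1. etabar * (decay (Suc t))\<^sup>2 / 2 * (gradF (x (vc \<omega>) (Suc t)) \<bullet> vc \<omega> (Suc t))\<^sup>2)"
      using second_moment_direction(1) by (intro Bochner_Integration.integrable_sum integrable_mult_right) auto
  qed
  finally have upper: "(\<Sum>t<T - 1. etabar * (decay (Suc t))\<^sup>2 / 2 * (E (Suc t) / real d)) \<le> B" .
  \<comment> \<open>The threshold on \<open>T\<close> contains the summand \<open>2\<close> to make \<open>T - 1\<close> at least \<open>T / 2\<close>.\<close>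
  have T: "real T > 4"
  proof -
    have "2\<^sup>2 < (sqrt (real T))\<^sup>2"
      using False pos by (intro power_strict_mono) auto
    then show ?thesis by simp
  qed
  have "etabar * sqrt (real T) * m / (4 * real d) = (real T / 2) * (etabar * (1 / sqrt (real T)) / 2 * (m / real d))"
    by (subst real_div_sqrt [of "real T", symmetric]) (simp_all add: field_simps)
  also have "\<dots> \<le> real (T - 1) * (etabar * (1 / sqrt (real T)) / 2 * (m / real d))"
    using T m_nonneg pos by (intro mult_right_mono) auto
  also have "\<dots> = (\<Sum>t<T - 1. etabar * (1 / sqrt (real T)) / 2 * (m / real d))"
    by simp
  also have "\<dots> \<le> (\<Sum>t<T - 1. etabar * (decay (Suc t))\<^sup>2 / 2 * (E (Suc t) / real d))"
  proof (intro sum_mono mult_mono divide_right_mono mult_left_mono m_le)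
    show "1 / sqrt (real T) \<le> (decay (Suc t))\<^sup>2" if "t \<in> {..<T - 1}" for t
      using that unfolding decay_squared by (intro divide_left_mono) auto
  qed (use pos m_nonneg in auto)
  also note upper
  finally have "m \<le> 4 * budget / etabar * (1 + ln (real T)) * (real d / sqrt (real T))"
    using T pos dTK by (simp add: B_def field_simps)
  also have "\<dots> \<le> rate * (1 + ln (real T)) * (real d / sqrt (real T))"
    using pos constants_nonneg T by (intro mult_right_mono) (auto simp: rate_def)
  finally have "m \<le> rate * (1 + ln (real T)) * (real d / sqrt (real T))" .
  moreover have "m \<in> E ` {0..T}"
    unfolding m_def by (intro Min_in) auto
  ultimately show ?thesis by (auto simp: E_def)
qed

text \<open>
  The iterates agree almost surely.  On the remaining null set, however, the unclipped ones may behave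
  so badly that the integrand is not measurable; the integral is then \<open>0\<close> by convention, which still gives an inequality.
\<close>

lemma expectation_le_clipped:
  assumes "t \<le> T"
  shows "P.expectation (\<lambda>\<omega>. (norm (gradF (x (\<lambda>s. v s \<omega>) t)))\<^sup>2)
    \<le> P.expectation (\<lambda>\<omega>. (norm (gradF (x (vc \<omega>) t)))\<^sup>2)"
proof (cases "integrable P (\<lambda>\<omega>. (norm (gradF (x (\<lambda>s. v s \<omega>) t)))\<^sup>2)")
  case True
  have "AE \<omega> in P. \<forall>s\<in>{..<T}. v s \<omega> \<in> unit_dirs d"
  proof (rule AE_finite_allI)
    fix s assume "s \<in> {..<T}"
    then have law: "distr P borel (v s) = unif_sphere d"
      using iid by (simp add: iid_unif_sphere_def)
    have "AE z in distr P borel (v s). z \<in> unit_dirs d"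
      unfolding law by (rule AE_unif_sphere_unit_dirs [OF dTK(1)])
    then show "AE \<omega> in P. v s \<omega> \<in> unit_dirs d"
      using \<open>s \<in> {..<T}\<close> by (intro AE_distrD [OF v_measurable]) auto
  qed simp
  then have "AE \<omega> in P. x (\<lambda>s. v s \<omega>) t = x (vc \<omega>) t"
  proof eventually_elim
    case (elim \<omega>)
    then show ?case
      unfolding x_def using assms by (intro arg_cong [of _ _ fst] two_loop_cong) (auto simp: vc_def clip_id)
  qed
  then have "AE \<omega> in P. (norm (gradF (x (\<lambda>s. v s \<omega>) t)))\<^sup>2 = (norm (gradF (x (vc \<omega>) t)))\<^sup>2"
    by eventually_elim simp
  moreover have "(\<lambda>\<omega>. (norm (gradF (x (vc \<omega>) t)))\<^sup>2) \<in> borel_measurable P"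
    unfolding norm_gradF_squared [OF x_vc_in] using assms
    by (intro borel_measurable_sum borel_measurable_power measurable_coord_gradF x_vc_measurable x_vc_in)
  ultimately show ?thesis
    using True by (intro eq_refl integral_cong_AE) auto
next
  case False
  then show ?thesis by (simp add: not_integrable_integral_eq)
qed

lemma Min_expectation_le:
  "(MIN t\<in>{0..T}. P.expectation (\<lambda>\<omega>. (norm (gradF (x (\<lambda>s. v s \<omega>) t)))\<^sup>2))
    \<le> rate * (1 + ln (real T)) * (real d / sqrt (real T))"
proof -
  obtain t where t: "t \<in> {0..T}" "P.expectation (\<lambda>\<omega>. (norm (gradF (x (vc \<omega>) t)))\<^sup>2)
      \<le> rate * (1 + ln (real T)) * (real d / sqrt (real T))"
    using exists_small_gradient by blast
  have "(MIN t\<in>{0..T}. P.expectation (\<lambda>\<omega>. (norm (gradF (x (\<lambda>s. v s \<omega>) t)))\<^sup>2))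
      \<le> P.expectation (\<lambda>\<omega>. (norm (gradF (x (\<lambda>s. v s \<omega>) t)))\<^sup>2)"
    using t(1) by (intro Min_le) auto
  also have "\<dots> \<le> P.expectation (\<lambda>\<omega>. (norm (gradF (x (vc \<omega>) t)))\<^sup>2)"
    using t(1) by (intro expectation_le_clipped) simp
  finally show ?thesis using t(2) by simp
qed

end
end

theorem corollary1:
  fixes Y :: "(real ^ 'm) set"
    and Lx Ly ly LS Lt lt C2 C3 lam etabar deltabar gap :: real
  assumes "convex Y" and "compact Y"
    and "lt > 0" and "C2 > 0" and "C3 > 0" and "lam > 0"
    and "etabar > 0" and "deltabar > 0"
  shows "\<exists>(M :: real) (p :: nat). \<forall>(d :: nat) (T :: nat) (K :: nat)
           (f :: rvec \<Rightarrow> real ^ 'm \<Rightarrow> real) (G :: rvec \<Rightarrow> real ^ 'm \<Rightarrow> real ^ 'm)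
           (H :: nat \<Rightarrow> real ^ 'm \<Rightarrow> rvec \<Rightarrow> real ^ 'm) (x0 :: rvec) (y0 :: real ^ 'm) (y0' :: real ^ 'm)
           (P :: 'w measure) (v :: nat \<Rightarrow> 'w \<Rightarrow> rvec).
         d \<ge> 1 \<and> T \<ge> 1 \<and> K \<ge> 1 \<and>
         C2_on (Rn d \<times> Y) (\<lambda>(x, y). f x y) \<and> C2_on (Rn d \<times> Y) (\<lambda>(x, y). G x y) \<and>
         update_maps d Y H \<and>
         assumption_A1 d Y f G Lx Ly ly LS Lt lt \<and>
         assumption_A2 d Y H K C2 \<and>
         assumption_A3_1a d Y G H C3 lam \<and>
         x0 \<in> Rn d \<and> y0 \<in> Y \<and> y0' \<in> Y \<and>
         (\<forall>x\<in>Rn d. hyper_objective Y f G x0 - hyper_objective Y f G x \<le> gap) \<and>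
         etabar \<le> real d / (2 * lt) \<and>
         real K \<ge> real T powr (1 / (2 * lam)) * real d powr (2 / lam) \<and>
         iid_unif_sphere P d T v
         \<longrightarrow>
         (let \<eta> = (\<lambda>t. etabar * (real t + 1) powr (- 1 / 2) * real d powr (- 1));
              \<delta> = (\<lambda>t. deltabar * (real t + 1) powr (- 1 / 4) * real d powr (- 1 / 2));
              x = (\<lambda>t \<omega>. fst (two_loop d K f H \<eta> \<delta> (\<lambda>s. v s \<omega>) (x0, y0, y0') t))
          in (MIN t\<in>{0..T}. prob_space.expectation P
                (\<lambda>\<omega>. (norm (grad (Rn d) (hyper_objective Y f G) (x t \<omega>)))\<^sup>2))
             \<le> M * (1 + ln (real T)) ^ p * (real d / sqrt (real T)))"
proof -
  obtain D where D: "\<And>y y'. y \<in> Y \<Longrightarrow> y' \<in> Y \<Longrightarrow> norm (y - y') \<le> D"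
    using compact_imp_bounded [OF assms(2)] by (metis bounded_two_points dist_norm)
  interpret c: rate_constants Lx Ly LS Lt lt C2 C3 etabar deltabar gap D .
  show ?thesis
  proof (intro exI [of _ c.rate] exI [of _ "1 :: nat"] allI impI, elim conjE)
    fix d T K :: nat and f :: "rvec \<Rightarrow> real ^ 'm \<Rightarrow> real" and G :: "rvec \<Rightarrow> real ^ 'm \<Rightarrow> real ^ 'm"
      and H :: "nat \<Rightarrow> real ^ 'm \<Rightarrow> rvec \<Rightarrow> real ^ 'm" and x0 :: rvec and y0 y0' :: "real ^ 'm"
      and P :: "'w measure" and v :: "nat \<Rightarrow> 'w \<Rightarrow> rvec"
    assume *: "1 \<le> d" "1 \<le> T" "1 \<le> K" "C2_on (Rn d \<times> Y) (\<lambda>(x, y). f x y)" "update_maps d Y H"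
      "assumption_A1 d Y f G Lx Ly ly LS Lt lt" "assumption_A2 d Y H K C2"
      "assumption_A3_1a d Y G H C3 lam" "x0 \<in> Rn d" "y0 \<in> Y" "y0' \<in> Y"
      "\<forall>x\<in>Rn d. hyper_objective Y f G x0 - hyper_objective Y f G x \<le> gap"
      "real T powr (1 / (2 * lam)) * real d powr (2 / lam) \<le> real K"
      and iid: "iid_unif_sphere P d T v"
    interpret g: two_loop_game Lx Ly LS Lt lt C2 C3 etabar deltabar gap D Y ly lam d T K f G H x0 y0 y0'
      using * assms(3-) D by unfold_locales auto
    show "let \<eta> = (\<lambda>t. etabar * (real t + 1) powr (- 1 / 2) * real d powr (- 1));
              \<delta> = (\<lambda>t. deltabar * (real t + 1) powr (- 1 / 4) * real d powr (- 1 / 2));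
              x = (\<lambda>t \<omega>. fst (two_loop d K f H \<eta> \<delta> (\<lambda>s. v s \<omega>) (x0, y0, y0') t))
          in (MIN t\<in>{0..T}. prob_space.expectation P
                (\<lambda>\<omega>. (norm (grad (Rn d) (hyper_objective Y f G) (x t \<omega>)))\<^sup>2))
             \<le> c.rate * (1 + ln (real T)) ^ 1 * (real d / sqrt (real T))"
      using g.Min_expectation_le [OF iid]
      unfolding g.x_def g.eta_def [abs_def] g.delta_def [abs_def] Let_def power_one_right .
  qed
qed

end
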